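(* There exist a family of functions $f=f_n\colon\{0,1\}^n\to\{0,1\}$ and of ($0$-biased) product distributions $\mu=\mu_n$ over $\{0,1\}^n$ such that, as $n\to\infty$, $$\mathsf{D}^\times(f)=\Theta(\mathsf{disc}(f,\mu))=\Theta(\log n)\qquad\text{and}\qquad \mathsf{S}_0(f,\mu)=\Theta(1).$$
   Context: Inner products are over $\mathbb{F}_2$: $\langle a,x\rangle=\sum_i a_ix_i \bmod 2$. A deterministic parity decision tree $T$ on $\{0,1\}^n$ is a rooted binary tree in which every internal node is labelled by a vector $a\in\{0,1\}^n$ (the query $\langle a,x\rangle$) and has two children, one for each outcome in $\{0,1\}$, and every leaf is labelled by an output bit; $T(x)$ is the label of the leaf reached on input $x$, and $q(T,x)$ is the number of queries made by $T$ on $x$; the depth of $T$ is the maximum of $q(T,x)$ over root-to-leaf paths. A randomised parity decision tree $\mathcal{T}$ is a probability distribution over deterministic ones. For a distribution $\nu$ on $\{0,1\}^n$, $\overline{q}(\mathcal{T},\nu)=\mathbb{E}_{T\sim\mathcal{T},x\sim\nu}[q(T,x)]$ and $\mathrm{err}_f(\mathcal{T},\nu)=\Pr_{T\sim\mathcal{T},x\sim\nu}[T(x)\ne f(x)]$. $\mathsf{D}_\epsilon(f,\nu)$ is the least depth of a deterministic parity decision tree $T$ with $\Pr_{x\sim\nu}[T(x)\ne f(x)]\le\epsilon$. A distribution on $\{0,1\}^n$ is product if it is a product of $n$ independent Bernoulli distributions. $\mathsf{D}^\times(f)=\max_{\nu\text{ product}}\mathsf{D}_{1/3}(f,\nu)$.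 $\mathsf{disc}(f,\mu)=-\log_2\max_S\left|\sum_{x\in S}(-1)^{f(x)}\mu(x)\right|$, the maximum over all affine subspaces $S$ of $\{0,1\}^n=\mathbb{F}_2^n$. A product distribution $\mu$ is $0$-biased if $\Pr_{x\sim\mu}[x_i=0]\ge 1/2$ for every $i$. For such $\mu$ put $\delta_i=2\Pr_{x\sim\mu}[x_i=1]\in[0,1]$. The random partial fixing $\mathcal{R}_\mu$ is the distribution of $\rho\in\{0,\star\}^n$ with independent coordinates, $\rho_i=0$ with probability $1-\delta_i$ and $\rho_i=\star$ with probability $\delta_i$. $\mathcal{U}_\rho$ is the uniform distribution on $\{x\in\{0,1\}^n: x_i=0 \text{ whenever }\rho_i=0\}$. For a deterministic tree $T$ and $\rho\in\{0,\star\}^n$, $T_\rho$ is the tree obtained from $T$ by fixing $x_i=0$ for all $i$ with $\rho_i=0$ (so each query is restricted to the coordinates with $\rho_i=\star$) and then removing redundant queries, i.e. those whose restricted query vector is an $\mathbb{F}_2$-linear combination of the restricted query vectors made earlier on the path (their answers are determined by the earlier ones). For randomised $\mathcal{T}$, $\mathcal{T}_\rho$ is the distribution of $T_\rho$ with $T\sim\mathcal{T}$. Skew average cost: $\overline{sq}(\mathcal{T},\mu)=\mathbb{E}_{\rho\sim\mathcal{R}_\mu}[\overline{q}(\mathcal{T}_\rho,\mathcal{U}_\rho)]$. Skew measure: $\mathsf{S}_\epsilon(f,\mu)=\min_{\mathcal{T}}\{\overline{sq}(\mathcal{T},\mu):\mathrm{err}_f(\mathcal{T},\mu)\le\epsilon\}$,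 the minimum over randomised parity decision trees. *)

theory Defs
  imports
    "HOL-Probability.Probability"
    "HOL-Library.Z2"
    "HOL-Library.Function_Algebras"
    "HOL-Library.Landau_Symbols"
begin

section \<open>Vectors over the field with two elements\<close>

text \<open>
  The dimension \<open>n\<close> varies inside the statement, so vectors are functions of type
  \<open>nat \<Rightarrow> bit\<close>, and \<open>{0,1}^n\<close> is the set of those that vanish from index \<open>n\<close> on.
  Addition of vectors is the pointwise addition of functions.
\<close>

definition cube :: "nat \<Rightarrow> (nat \<Rightarrow> bit) set" where
  "cube n = {x. \<forall>i\<ge>n. x i = 0}"

definition ip :: "nat \<Rightarrow> (nat \<Rightarrow> bit) \<Rightarrow> (nat \<Rightarrow> bit) \<Rightarrow> bit" where
  "ip n a x = (\<Sum>i<n. a i * x i)"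

definition scale_vec :: "bit \<Rightarrow> (nat \<Rightarrow> bit) \<Rightarrow> nat \<Rightarrow> bit" where
  "scale_vec c v = (\<lambda>i. c * v i)"

interpretation F2: vector_space scale_vec
  by unfold_locales
    (auto simp: scale_vec_def fun_eq_iff algebra_simps simp del: add_bit_eq_xor mult_bit_eq_and)

definition affine_subspace :: "nat \<Rightarrow> (nat \<Rightarrow> bit) set \<Rightarrow> bool" where
  "affine_subspace n S \<longleftrightarrow>
     (\<exists>a V. a \<in> cube n \<and> F2.subspace V \<and> V \<subseteq> cube n \<and> S = (\<lambda>v. a + v) ` V)"


section \<open>Parity decision trees\<close>

text \<open>In \<open>Query a l r\<close>, the subtree \<open>l\<close> is for the answer 0 and \<open>r\<close> for the answer 1.\<close>

datatype ptree = Leaf bit | Query "nat \<Rightarrow> bit" ptree ptree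

fun ptree_on :: "nat \<Rightarrow> ptree \<Rightarrow> bool" where
  "ptree_on n (Leaf b) \<longleftrightarrow> True"
| "ptree_on n (Query a l r) \<longleftrightarrow> a \<in> cube n \<and> ptree_on n l \<and> ptree_on n r"

fun eval_tree :: "nat \<Rightarrow> ptree \<Rightarrow> (nat \<Rightarrow> bit) \<Rightarrow> bit" where
  "eval_tree n (Leaf b) x = b"
| "eval_tree n (Query a l r) x = (if ip n a x = 0 then eval_tree n l x else eval_tree n r x)"

fun queries :: "nat \<Rightarrow> ptree \<Rightarrow> (nat \<Rightarrow> bit) \<Rightarrow> nat" where
  "queries n (Leaf b) x = 0"
| "queries n (Query a l r) x = Suc (if ip n a x = 0 then queries n l x else queries n r x)"

fun depth :: "ptree \<Rightarrow> nat" where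
  "depth (Leaf b) = 0"
| "depth (Query a l r) = Suc (max (depth l) (depth r))"

text \<open>
  There are only countably many trees with labels in \<open>cube n\<close>, so every probability
  distribution on them is a \<open>pmf\<close>. The support may be infinite and the depth unbounded, hence
  expected costs are defined as \<open>ennreal\<close>-valued integrals (the Bochner integral of a
  non-integrable function would be 0).
\<close>

definition rand_ptree_on :: "nat \<Rightarrow> ptree pmf \<Rightarrow> bool" where
  "rand_ptree_on n R \<longleftrightarrow> (\<forall>T\<in>set_pmf R. ptree_on n T)"

definition avg_queries :: "nat \<Rightarrow> ptree pmf \<Rightarrow> (nat \<Rightarrow> bit) pmf \<Rightarrow> ennreal" where
  "avg_queries n R \<nu> =
     (\<integral>\<^sup>+ (T, x). ennreal (real (queries n T x)) \<partial>measure_pmf (pair_pmf R \<nu>))"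

definition err :: "nat \<Rightarrow> ((nat \<Rightarrow> bit) \<Rightarrow> bit) \<Rightarrow> ptree pmf \<Rightarrow> (nat \<Rightarrow> bit) pmf \<Rightarrow> real" where
  "err n f R \<nu> = measure_pmf.prob (pair_pmf R \<nu>) {(T, x). eval_tree n T x \<noteq> f x}"


section \<open>Distributional complexity and discrepancy\<close>

definition product_dist :: "nat \<Rightarrow> (nat \<Rightarrow> bit) pmf \<Rightarrow> bool" where
  "product_dist n \<nu> \<longleftrightarrow>
     (\<exists>p. (\<forall>i<n. 0 \<le> p i \<and> p i \<le> 1) \<and>
          \<nu> = Pi_pmf {..<n} 0 (\<lambda>i. map_pmf of_bool (bernoulli_pmf (p i))))"

definition D_complexity ::
    "nat \<Rightarrow> real \<Rightarrow> ((nat \<Rightarrow> bit) \<Rightarrow> bit) \<Rightarrow> (nat \<Rightarrow> bit) pmf \<Rightarrow> nat" where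
  "D_complexity n \<epsilon> f \<nu> =
     (LEAST d. \<exists>T. ptree_on n T \<and> depth T = d \<and>
                   measure_pmf.prob \<nu> {x. eval_tree n T x \<noteq> f x} \<le> \<epsilon>)"

text \<open>The maximum exists because \<open>D_complexity n \<epsilon> f \<nu> \<le> n\<close> for \<open>\<epsilon> \<ge> 0\<close> and product \<open>\<nu>\<close>.\<close>

definition D_product :: "nat \<Rightarrow> ((nat \<Rightarrow> bit) \<Rightarrow> bit) \<Rightarrow> nat" where
  "D_product n f = Max (D_complexity n (1/3) f ` {\<nu>. product_dist n \<nu>})"

definition disc :: "nat \<Rightarrow> ((nat \<Rightarrow> bit) \<Rightarrow> bit) \<Rightarrow> (nat \<Rightarrow> bit) pmf \<Rightarrow> real" where
  "disc n f \<mu> =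
     - log 2 (Max ((\<lambda>S. \<bar>\<Sum>x\<in>S. (if f x = 0 then 1 else -1) * pmf \<mu> x\<bar>)
                    ` {S. affine_subspace n S}))"


section \<open>Skew cost\<close>

definition zero_biased :: "nat \<Rightarrow> (nat \<Rightarrow> bit) pmf \<Rightarrow> bool" where
  "zero_biased n \<mu> \<longleftrightarrow>
     product_dist n \<mu> \<and> (\<forall>i<n. measure_pmf.prob \<mu> {x. x i = 0} \<ge> 1/2)"

definition star_prob :: "(nat \<Rightarrow> bit) pmf \<Rightarrow> nat \<Rightarrow> real" where
  "star_prob \<mu> i = 2 * measure_pmf.prob \<mu> {x. x i = 1}"

text \<open>
  A partial fixing in \<open>{0,\<star>}^n\<close> is a function of type \<open>nat \<Rightarrow> bool\<close>: the value \<open>True\<close> stands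
  for \<open>\<star>\<close> (free), and \<open>False\<close> for a coordinate fixed to 0.
\<close>

definition random_fixing :: "nat \<Rightarrow> (nat \<Rightarrow> bit) pmf \<Rightarrow> (nat \<Rightarrow> bool) pmf" where
  "random_fixing n \<mu> = Pi_pmf {..<n} False (\<lambda>i. bernoulli_pmf (star_prob \<mu> i))"

definition unif_fixing :: "nat \<Rightarrow> (nat \<Rightarrow> bool) \<Rightarrow> (nat \<Rightarrow> bit) pmf" where
  "unif_fixing n \<rho> = pmf_of_set {x \<in> cube n. \<forall>i<n. \<not> \<rho> i \<longrightarrow> x i = 0}"

fun fix_zeros :: "(nat \<Rightarrow> bool) \<Rightarrow> ptree \<Rightarrow> ptree" where
  "fix_zeros \<rho> (Leaf b) = Leaf b"
| "fix_zeros \<rho> (Query a l r) =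
     Query (\<lambda>i. if \<rho> i then a i else 0) (fix_zeros \<rho> l) (fix_zeros \<rho> r)"

text \<open>
  In \<open>prune n H T\<close>, the set \<open>H\<close> holds the (query, answer) pairs kept so far on the path. A query
  in the span of the earlier ones is removed, and the tree continues in the child for the only
  answer consistent with \<open>H\<close>. Only queries outside the span enter \<open>H\<close>, so when starting
  from \<open>H = {}\<close> the set \<open>H\<close> is always satisfiable and that answer is unique. Removed queries do
  not change the span.
\<close>

definition forced :: "nat \<Rightarrow> ((nat \<Rightarrow> bit) \<times> bit) set \<Rightarrow> (nat \<Rightarrow> bit) \<Rightarrow> bit \<Rightarrow> bool" where
  "forced n H a b \<longleftrightarrow> (\<forall>x\<in>cube n. (\<forall>(c, d)\<in>H. ip n c x = d) \<longrightarrow> ip n a x = b)"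

fun prune :: "nat \<Rightarrow> ((nat \<Rightarrow> bit) \<times> bit) set \<Rightarrow> ptree \<Rightarrow> ptree" where
  "prune n H (Leaf b) = Leaf b"
| "prune n H (Query a l r) =
     (if a \<in> F2.span (fst ` H)
      then if forced n H a 0 then prune n H l else prune n H r
      else Query a (prune n (insert (a, 0) H) l) (prune n (insert (a, 1) H) r))"

definition apply_fixing :: "nat \<Rightarrow> (nat \<Rightarrow> bool) \<Rightarrow> ptree \<Rightarrow> ptree" where
  "apply_fixing n \<rho> T = prune n {} (fix_zeros \<rho> T)"

definition skew_cost :: "nat \<Rightarrow> ptree pmf \<Rightarrow> (nat \<Rightarrow> bit) pmf \<Rightarrow> ennreal" where
  "skew_cost n R \<mu> =
     (\<integral>\<^sup>+ \<rho>. avg_queries n (map_pmf (apply_fixing n \<rho>) R) (unif_fixing n \<rho>)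
        \<partial>measure_pmf (random_fixing n \<mu>))"

text \<open>
  For \<open>\<epsilon> \<ge> 0\<close> and zero-biased \<open>\<mu>\<close> the infimum is a minimum and at most \<open>n\<close>: removing
  redundant queries from the trees in the support changes neither error nor skew cost, and only
  finitely many trees without redundant queries exist, so a continuous function is minimised
  over a compact set.
\<close>

definition skew_measure ::
    "nat \<Rightarrow> real \<Rightarrow> ((nat \<Rightarrow> bit) \<Rightarrow> bit) \<Rightarrow> (nat \<Rightarrow> bit) pmf \<Rightarrow> real" where
  "skew_measure n \<epsilon> f \<mu> =
     enn2real (INF R\<in>{R. rand_ptree_on n R \<and> err n f R \<mu> \<le> \<epsilon>}. skew_cost n R \<mu>)"

end

theory Submission
  imports Defs
begin

text \<open>
  Let \<open>N = 2 ^ k\<close> with \<open>k\<close> about \<open>log n / 2\<close>. The input consists of \<open>t = 3 * k\<close> blocks of \<open>N\<close>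
  bits, each equal to 1 with probability \<open>1 / (2 * N)\<close>, and of \<open>k\<close> uniform bits \<open>y\<close>. A block
  is flagged if its parity is 1. The function value is the inner product of \<open>y\<close> with the sum
  \<open>h\<close> of the binary expansions of the positions of the ones in the last flagged block;
  if no block is flagged, \<open>h\<close> is a fixed unit vector, so that \<open>f\<close> stays nonconstant under every fixing.

  Since the expected number of stars in a block is 1 and a block is flagged with probability at
  least 1/4, reading the blocks bit by bit until one is flagged has constant expected skew cost.
  By symmetry \<open>h\<close> is uniform on flagged inputs, and an inner product with uniform \<open>y\<close> correlates
  with an affine subspace at most as much as the largest point mass of \<open>h\<close>, so the discrepancy
  is \<open>\<Omega>(k)\<close>, and so is the depth of a tree with small error. Conversely, \<open>f\<close> is bilinear in \<open>y\<close>
  and the selected block: after reading \<open>y\<close>, one parity query per block to find the flagged one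
  and one further query compute \<open>f\<close> exactly, with \<open>O(k)\<close> queries.
\<close>

section \<open>Correlation with affine subspaces\<close>

text \<open>These rules rewrite addition and multiplication of bits to boolean operations.\<close>

declare add_bit_eq_xor [simp del] mult_bit_eq_and [simp del]

section \<open>Signs, vectors and affine subspaces over the field with two elements\<close>

definition sgnb :: "bit \<Rightarrow> real" where
  "sgnb b = (if b = 0 then 1 else -1)"

lemma sgnb_simps [simp]: "sgnb 0 = 1" "sgnb 1 = -1"
  by (simp_all add: sgnb_def)

lemma abs_sgnb [simp]: "\<bar>sgnb b\<bar> = 1"
  by (simp add: sgnb_def)

lemma bit_add_self [simp]: "b + b = (0 :: bit)"
  by (cases b) simp_all

lemma sgnb_add: "sgnb (a + b) = sgnb a * sgnb b"
  by (cases a; cases b) simp_all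

lemma sgnb_sum: "sgnb (sum g A) = (\<Prod>u\<in>A. sgnb (g u))"
  by (induction A rule: infinite_finite_induct) (simp_all add: sgnb_add)

lemma vec_add_self [simp]: "x + x = (0 :: nat \<Rightarrow> bit)"
  by (simp add: fun_eq_iff)

lemma vec_add_self_left [simp]: "x + (x + y) = (y :: nat \<Rightarrow> bit)"
  by (simp add: fun_eq_iff)

lemma vec_add_self_right [simp]: "x + y + y = (x :: nat \<Rightarrow> bit)"
  by (simp add: fun_eq_iff add.assoc)

lemma UNIV_bit: "UNIV = {0, 1 :: bit}"
  using bit.exhaust by blast

lemma cube_0 [simp]: "0 \<in> cube n"
  by (simp add: cube_def)

lemma cube_add [simp]: "x \<in> cube n \<Longrightarrow> y \<in> cube n \<Longrightarrow> x + y \<in> cube n"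
  by (simp add: cube_def)

lemma finite_cube [simp]: "finite (cube n)"
proof -
  have "cube n = PiE_dflt {..<n} 0 (\<lambda>_. UNIV)"
    by (auto simp: cube_def PiE_dflt_def)
  also have "finite \<dots>"
    by (intro finite_PiE_dflt) (auto simp: UNIV_bit)
  finally show ?thesis .
qed

lemma ip_add_right: "ip n a (x + y) = ip n a x + ip n a y"
  by (simp add: ip_def algebra_simps sum.distrib)

lemma ip_add_left: "ip n (a + b) x = ip n a x + ip n b x"
  by (simp add: ip_def algebra_simps sum.distrib)

lemma ip_commute: "ip n a x = ip n x a"
  by (simp add: ip_def mult.commute)

lemma ip_0 [simp]: "ip n a 0 = 0" "ip n 0 a = 0"
  by (simp_all add: ip_def)

definition unit_vec :: "nat \<Rightarrow> nat \<Rightarrow> bit" where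
  "unit_vec u = (\<lambda>v. of_bool (v = u))"

lemma unit_vec_cube [simp]: "u < n \<Longrightarrow> unit_vec u \<in> cube n"
  by (simp add: unit_vec_def cube_def)

lemma ip_unit_vec [simp]: "u < n \<Longrightarrow> ip n (unit_vec u) x = x u"
  by (simp add: ip_def unit_vec_def if_distrib[of "\<lambda>c. c * _"] of_bool_def sum.delta cong: if_cong)

text \<open>Over two scalars the affine combinations are the sums of an odd number of points, and
  sums of three generate them. This form mentions no base point, so closure under restriction to an
  answer of a query is immediate.\<close>

lemma affine_subspace_iff:
  "affine_subspace n S \<longleftrightarrow>
     S \<noteq> {} \<and> S \<subseteq> cube n \<and> (\<forall>x\<in>S. \<forall>y\<in>S. \<forall>z\<in>S. x + y + z \<in> S)"
proof (intro iffI)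
  assume "affine_subspace n S"
  then obtain a V where a: "a \<in> cube n" "F2.subspace V" "V \<subseteq> cube n" "S = (\<lambda>v. a + v) ` V"
    by (auto simp: affine_subspace_def)
  have "x + y + z \<in> S" if xyz: "x \<in> S" "y \<in> S" "z \<in> S" for x y z
  proof -
    obtain p q r where "p \<in> V" "q \<in> V" "r \<in> V" "x = a + p" "y = a + q" "z = a + r"
      using xyz a by auto
    moreover have "(a + p) + (a + q) + (a + r) = a + (p + q + r)"
      by (simp add: fun_eq_iff algebra_simps)
    ultimately show ?thesis
      using a F2.subspace_add by auto
  qed
  moreover have "S \<noteq> {}" "S \<subseteq> cube n"
    using a F2.subspace_0 by auto
  ultimately show "S \<noteq> {} \<and> S \<subseteq> cube n \<and> (\<forall>x\<in>S. \<forall>y\<in>S. \<forall>z\<in>S. x + y + z \<in> S)"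
    by blast
next
  assume "S \<noteq> {} \<and> S \<subseteq> cube n \<and> (\<forall>x\<in>S. \<forall>y\<in>S. \<forall>z\<in>S. x + y + z \<in> S)"
  then obtain s where S: "S \<subseteq> cube n" "\<forall>x\<in>S. \<forall>y\<in>S. \<forall>z\<in>S. x + y + z \<in> S" and s: "s \<in> S"
    by blast
  define V where "V = (\<lambda>v. s + v) ` S"
  have "F2.subspace V"
    unfolding F2.subspace_def
  proof safe
    show "0 \<in> V"
      using s unfolding V_def by (intro image_eqI[of _ _ s]) auto
    show "x + y \<in> V" if "x \<in> V" "y \<in> V" for x y
    proof -
      obtain p q where "p \<in> S" "q \<in> S" "x = s + p" "y = s + q"
        using \<open>x \<in> V\<close> \<open>y \<in> V\<close> by (auto simp: V_def)
      moreover have "(s + p) + (s + q) = s + (s + p + q)"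
        by (simp add: ac_simps)
      ultimately show ?thesis
        using S s unfolding V_def by blast
    qed
    show "scale_vec c x \<in> V" if "x \<in> V" for c x
    proof (cases "c = 0")
      case True
      have "scale_vec 0 x = 0"
        by (simp add: scale_vec_def fun_eq_iff)
      then show ?thesis
        using \<open>0 \<in> V\<close> True by simp
    next
      case False
      then show ?thesis
        using that by (simp add: scale_vec_def)
    qed
  qed
  moreover have "S = (\<lambda>v. s + v) ` V"
    by (simp add: V_def image_image)
  moreover have "V \<subseteq> cube n" "s \<in> cube n"
    using S(1) s by (auto simp: V_def subset_iff)
  ultimately show "affine_subspace n S"
    unfolding affine_subspace_def by blast
qed

text \<open>If some \<open>g\<close> in \<open>G\<close> has \<open>ip n w g = 1\<close>, adding
  \<open>g\<close> permutes \<open>G\<close> and flips every sign, so the sum equals its own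
  negative.\<close>

lemma character_sum:
  assumes "finite G" "\<And>v w. v \<in> G \<Longrightarrow> w \<in> G \<Longrightarrow> v + w \<in> G"
  shows "(\<Sum>v\<in>G. sgnb (ip n w v)) = (if \<forall>v\<in>G. ip n w v = 0 then real (card G) else 0)"
proof (cases "\<forall>v\<in>G. ip n w v = 0")
  case False
  then obtain g where g: "g \<in> G" "ip n w g = 1"
    by auto
  have "(\<Sum>v\<in>G. sgnb (ip n w v)) = (\<Sum>v\<in>G. sgnb (ip n w (v + g)))"
    using assms(2) g
    by (intro sum.reindex_bij_witness[of _ "\<lambda>v. v + g" "\<lambda>v. v + g"]) auto
  also have "\<dots> = - (\<Sum>v\<in>G. sgnb (ip n w v))"
    by (simp add: ip_add_right sgnb_add g sum_negf)
  finally show ?thesis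
    using False by auto
qed simp

section \<open>Coordinate subspaces, annihilators and bilinear correlation\<close>

definition coord_space :: "nat set \<Rightarrow> (nat \<Rightarrow> bit) set" where
  "coord_space I = {v. \<forall>u. u \<notin> I \<longrightarrow> v u = 0}"

lemma coord_space_0 [simp]: "0 \<in> coord_space I"
  by (simp add: coord_space_def)

lemma coord_space_add [simp]: "v \<in> coord_space I \<Longrightarrow> w \<in> coord_space I \<Longrightarrow> v + w \<in> coord_space I"
  by (simp add: coord_space_def)

lemma coord_space_cube: "I \<subseteq> {..<n} \<Longrightarrow> coord_space I \<subseteq> cube n"
  by (force simp: coord_space_def cube_def)

lemma finite_coord_space: "I \<subseteq> {..<n} \<Longrightarrow> finite (coord_space I)"
  using coord_space_cube finite_cube by (rule finite_subset)

text \<open>Double counting of the signs of \<open>ip n w v\<close>: summed over \<open>v\<close>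
  first, each \<open>w\<close> in the annihilator leaves \<open>card V\<close>; summed over
  \<open>w\<close> first, only \<open>v = 0\<close> survives. This is the dimension formula for
  annihilators in terms of cardinalities.\<close>

lemma card_annihilator:
  assumes I: "I \<subseteq> {..<n}" and V: "V \<subseteq> coord_space I" "0 \<in> V"
    and add: "\<And>v w. v \<in> V \<Longrightarrow> w \<in> V \<Longrightarrow> v + w \<in> V"
  shows "card V * card {w \<in> coord_space I. \<forall>v\<in>V. ip n w v = 0} = card (coord_space I)"
proof -
  let ?Y = "coord_space I"
  let ?W = "{w \<in> ?Y. \<forall>v\<in>V. ip n w v = 0}"
  have finY: "finite ?Y"
    by (rule finite_coord_space[OF I])
  have finV: "finite V"
    using V finY finite_subset by blast
  have zero: "v = 0" if "v \<in> V" "\<forall>w\<in>?Y. ip n v w = 0" for v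
  proof
    fix u
    show "v u = 0 u"
    proof (cases "u \<in> I")
      case True
      then have "unit_vec u \<in> ?Y"
        by (auto simp: coord_space_def unit_vec_def)
      then have "ip n v (unit_vec u) = 0"
        using that by blast
      then show ?thesis
        using True I by (subst (asm) ip_commute) auto
    next
      case False
      then show ?thesis
        using that V by (auto simp: coord_space_def)
    qed
  qed
  have "real (card V * card ?W) = (\<Sum>w\<in>?Y. if \<forall>v\<in>V. ip n w v = 0 then real (card V) else 0)"
    using finY by (simp add: sum.If_cases Int_def mult.commute)
  also have "\<dots> = (\<Sum>w\<in>?Y. \<Sum>v\<in>V. sgnb (ip n w v))"
    using character_sum[OF finV add] by simp
  also have "\<dots> = (\<Sum>v\<in>V. \<Sum>w\<in>?Y. sgnb (ip n v w))"
    by (subst sum.swap) (simp add: ip_commute)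
  also have "\<dots> = (\<Sum>v\<in>V. if v = 0 then real (card ?Y) else 0)"
    by (intro sum.cong refl, subst character_sum[OF finY]) (use zero in auto)
  also have "\<dots> = real (card ?Y)"
    using finV V by (simp add: sum.delta)
  finally show ?thesis
    by linarith
qed

text \<open>The \<open>v\<close> with \<open>z + v\<close> in \<open>S\<close> form the empty set or
  a coset \<open>v0 + V\<close>, where \<open>V\<close> consists of the directions of
  \<open>S\<close> inside \<open>coord_space I\<close>. Up to the sign of \<open>ip n w v0\<close>
  the sum is therefore a character sum over \<open>V\<close>.\<close>

lemma affine_character_sum:
  assumes I: "I \<subseteq> {..<n}" and S: "affine_subspace n S"
  defines "V \<equiv> {v \<in> coord_space I. \<forall>x\<in>S. x + v \<in> S}"
  shows "\<bar>\<Sum>v\<in>{v \<in> coord_space I. z + v \<in> S}. sgnb (ip n w v)\<bar>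
           \<le> (if \<forall>v\<in>V. ip n w v = 0 then real (card V) else 0)"
proof (cases "\<exists>v0 \<in> coord_space I. z + v0 \<in> S")
  case True
  then obtain v0 where v0: "v0 \<in> coord_space I" "z + v0 \<in> S"
    by blast
  have S3: "\<And>x y z. x \<in> S \<Longrightarrow> y \<in> S \<Longrightarrow> z \<in> S \<Longrightarrow> x + y + z \<in> S"
    using S by (simp add: affine_subspace_iff)
  have finV: "finite V"
    using finite_coord_space[OF I] by (simp add: V_def)
  have shift: "v + v0 \<in> V" if "v \<in> coord_space I" "z + v \<in> S" for v
  proof -
    have "x + (v + v0) \<in> S" if "x \<in> S" for x
    proof -
      have "x + (v + v0) = x + (z + v) + (z + v0)"
        by (simp add: ac_simps)
      then show ?thesis
        using that \<open>z + v \<in> S\<close> v0 S3 by metis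
    qed
    then show ?thesis
      using that v0 by (simp add: V_def)
  qed
  have "(\<Sum>v\<in>{v \<in> coord_space I. z + v \<in> S}. sgnb (ip n w v)) = (\<Sum>v\<in>V. sgnb (ip n w (v + v0)))"
    using shift v0
    by (intro sum.reindex_bij_witness[of _ "\<lambda>v. v + v0" "\<lambda>v. v + v0"])
       (auto simp: V_def ac_simps)
  also have "\<dots> = sgnb (ip n w v0) * (\<Sum>v\<in>V. sgnb (ip n w v))"
    by (simp add: ip_add_right sgnb_add sum_distrib_left mult.commute)
  finally have "\<bar>\<Sum>v\<in>{v \<in> coord_space I. z + v \<in> S}. sgnb (ip n w v)\<bar> = \<bar>\<Sum>v\<in>V. sgnb (ip n w v)\<bar>"
    by (simp only: abs_mult abs_sgnb mult_1)
  moreover have "(\<Sum>v\<in>V. sgnb (ip n w v)) = (if \<forall>v\<in>V. ip n w v = 0 then real (card V) else 0)"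
  proof (rule character_sum[OF finV])
    show "v + w \<in> V" if "v \<in> V" "w \<in> V" for v w
      using that unfolding V_def by (auto simp flip: add.assoc)
  qed
  ultimately show ?thesis
    by auto
next
  case False
  then have "{v \<in> coord_space I. z + v \<in> S} = {}"
    by blast
  then show ?thesis
    by (simp only: sum.empty abs_zero) simp
qed

text \<open>
  Averaging over the shifts by \<open>coord_space I\<close> turns the sum over \<open>S\<close> into the mass of the event
  that \<open>h\<close> lies in the annihilator of the directions of \<open>S\<close> inside \<open>coord_space I\<close>.
\<close>

lemma affine_correlation_le:
  fixes m :: "(nat \<Rightarrow> bit) \<Rightarrow> real"
  assumes I: "I \<subseteq> {..<n}" and S: "affine_subspace n S"
    and h: "\<And>z. h z \<in> coord_space I"
    and h_shift: "\<And>z v. v \<in> coord_space I \<Longrightarrow> h (z + v) = h z"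
    and m_shift: "\<And>z v. v \<in> coord_space I \<Longrightarrow> m (z + v) = m z"
    and m_nonneg: "\<And>z. m z \<ge> 0"
    and M: "\<And>w. w \<in> coord_space I \<Longrightarrow> (\<Sum>z\<in>{z \<in> cube n. h z = w}. m z) \<le> M"
  shows "\<bar>\<Sum>z\<in>S. sgnb (ip n (h z) z) * m z\<bar> \<le> M"
proof -
  let ?Y = "coord_space I"
  define V where "V = {v \<in> ?Y. \<forall>x\<in>S. x + v \<in> S}"
  define W where "W = {w \<in> ?Y. \<forall>v\<in>V. ip n w v = 0}"
  define s where "s = (\<lambda>z. sgnb (ip n (h z) z) * m z)"
  have finY: "finite ?Y"
    by (rule finite_coord_space[OF I])
  then have finW: "finite W"
    by (simp add: W_def)
  have Y_cube: "v \<in> cube n" if "v \<in> ?Y" for v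
    using that coord_space_cube[OF I] by blast
  have S_cube: "S \<subseteq> cube n"
    using S by (simp add: affine_subspace_iff)
  have card_VW: "card V * card W = card ?Y"
    unfolding W_def using I
    by (rule card_annihilator) (auto simp: V_def simp flip: add.assoc)
  have s_shift: "s (z + v) = sgnb (ip n (h z) v) * s z" if "v \<in> ?Y" for z v
    using that by (simp add: s_def h_shift m_shift ip_add_right sgnb_add)
  have translate: "(\<Sum>z\<in>S. s z) = (\<Sum>z\<in>{z \<in> cube n. z + v \<in> S}. s (z + v))" if "v \<in> ?Y" for v
    using Y_cube[OF that] S_cube
    by (intro sum.reindex_bij_witness[of _ "\<lambda>z. z + v" "\<lambda>z. z + v"]) (auto simp: add.assoc)
  have "real (card ?Y) * (\<Sum>z\<in>S. s z) = (\<Sum>v\<in>?Y. \<Sum>z\<in>S. s z)"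
    by simp
  also have "\<dots> = (\<Sum>v\<in>?Y. \<Sum>z\<in>{z \<in> cube n. z + v \<in> S}. sgnb (ip n (h z) v) * s z)"
    by (rule sum.cong[OF refl], subst translate, assumption) (simp add: s_shift)
  also have "\<dots> = (\<Sum>z\<in>cube n. \<Sum>v\<in>{v \<in> ?Y. z + v \<in> S}. sgnb (ip n (h z) v) * s z)"
    using finY by (rule sum.swap_restrict) simp
  also have "\<dots> = (\<Sum>z\<in>cube n. s z * (\<Sum>v\<in>{v \<in> ?Y. z + v \<in> S}. sgnb (ip n (h z) v)))"
    by (simp add: sum_distrib_left mult.commute)
  finally have "real (card ?Y) * \<bar>\<Sum>z\<in>S. s z\<bar>
      = \<bar>\<Sum>z\<in>cube n. s z * (\<Sum>v\<in>{v \<in> ?Y. z + v \<in> S}. sgnb (ip n (h z) v))\<bar>"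
    by (metis abs_mult abs_of_nat)
  also have "\<dots> \<le> (\<Sum>z\<in>cube n. m z * (if h z \<in> W then real (card V) else 0))"
  proof (rule order.trans[OF sum_abs], intro sum_mono)
    fix z
    have "\<bar>\<Sum>v\<in>{v \<in> ?Y. z + v \<in> S}. sgnb (ip n (h z) v)\<bar>
        \<le> (if h z \<in> W then real (card V) else 0)"
      using affine_character_sum[OF I S, where z = z and w = "h z"] h[of z]
      by (simp only: W_def V_def mem_Collect_eq simp_thms)
    then show "\<bar>s z * (\<Sum>v\<in>{v \<in> ?Y. z + v \<in> S}. sgnb (ip n (h z) v))\<bar>
        \<le> m z * (if h z \<in> W then real (card V) else 0)"
      unfolding s_def abs_mult using m_nonneg[of z] by (intro mult_mono) auto
  qed
  also have "\<dots> = real (card V) * (\<Sum>z\<in>{z \<in> cube n. h z \<in> W}. m z)"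
    by (simp add: sum_distrib_left sum.inter_filter mult.commute if_distrib cong: if_cong)
  \<comment> \<open>The event is split into the \<open>card W\<close> values of \<open>h\<close>,
    each of mass at most \<open>M\<close>; then \<open>card V * card W\<close> cancels against
    \<open>card ?Y\<close>.\<close>
  also have "(\<Sum>z\<in>{z \<in> cube n. h z \<in> W}. m z) = (\<Sum>w\<in>W. \<Sum>z\<in>{z \<in> {z \<in> cube n. h z \<in> W}. h z = w}. m z)"
    using finW by (intro sum.group[symmetric]) auto
  also have "\<dots> \<le> (\<Sum>w\<in>W. M)"
  proof (rule sum_mono)
    fix w assume w: "w \<in> W"
    then have "{z \<in> {z \<in> cube n. h z \<in> W}. h z = w} = {z \<in> cube n. h z = w}"
      by auto
    then show "(\<Sum>z\<in>{z \<in> {z \<in> cube n. h z \<in> W}. h z = w}. m z) \<le> M"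
      using M w by (simp add: W_def)
  qed
  also have "real (card V) * (\<Sum>w\<in>W. M) = real (card ?Y) * M"
    by (simp flip: card_VW)
  finally have "real (card ?Y) * \<bar>\<Sum>z\<in>S. s z\<bar> \<le> real (card ?Y) * M"
    by (simp add: mult_left_mono)
  moreover have "card ?Y > 0"
    using finY coord_space_0 unfolding card_gt_0_iff by blast
  ultimately show ?thesis
    by (simp add: s_def)
qed

section \<open>From affine correlation to the error of trees\<close>

lemma affine_halfspace:
  assumes "S = {} \<or> affine_subspace n S"
  shows "{x \<in> S. ip n a x = b} = {} \<or> affine_subspace n {x \<in> S. ip n a x = b}"
  using assms by (auto simp: affine_subspace_iff ip_add_right)

text \<open>The leaves cut \<open>S\<close> into at most \<open>2 ^ depth T\<close> pieces on which
  the output is constant, and each piece contributes at most \<open>M\<close>. Inconsistent answers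
  produce empty pieces, hence the alternative \<open>S = {}\<close>.\<close>

lemma tree_correlation_le:
  assumes M: "\<And>S. affine_subspace n S \<Longrightarrow> \<bar>\<Sum>x\<in>S. sgnb (f x) * m x\<bar> \<le> M" and "M \<ge> 0"
    and S: "S = {} \<or> affine_subspace n S"
  shows "(\<Sum>x\<in>S. sgnb (f x) * sgnb (eval_tree n T x) * m x) \<le> 2 ^ depth T * M"
  using S
proof (induction T arbitrary: S)
  case (Leaf b)
  have "(\<Sum>x\<in>S. sgnb (f x) * sgnb b * m x) = sgnb b * (\<Sum>x\<in>S. sgnb (f x) * m x)"
    by (simp add: sum_distrib_left mult_ac)
  also have "\<dots> \<le> \<bar>\<dots>\<bar>"
    by (rule abs_ge_self)
  also have "\<dots> \<le> M"
    using Leaf M \<open>M \<ge> 0\<close> by (auto simp: abs_mult)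
  finally show ?case
    by simp
next
  case (Query a l r)
  let ?g = "\<lambda>T x. sgnb (f x) * sgnb (eval_tree n T x) * m x"
  let ?S = "\<lambda>b. {x \<in> S. ip n a x = b}"
  have fin: "finite S"
    using Query.prems finite_subset[OF _ finite_cube] by (auto simp: affine_subspace_iff)
  have "(\<Sum>x\<in>S. ?g (Query a l r) x) = (\<Sum>x\<in>?S 0. ?g l x) + (\<Sum>x\<in>?S 1. ?g r x)"
  proof -
    have "(\<Sum>x\<in>?S 0 \<union> ?S 1. ?g (Query a l r) x)
        = (\<Sum>x\<in>?S 0. ?g (Query a l r) x) + (\<Sum>x\<in>?S 1. ?g (Query a l r) x)"
      using fin by (intro sum.union_disjoint) auto
    moreover have "?S 0 \<union> ?S 1 = S"
      by auto
    ultimately have "(\<Sum>x\<in>S. ?g (Query a l r) x)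
        = (\<Sum>x\<in>?S 0. ?g (Query a l r) x) + (\<Sum>x\<in>?S 1. ?g (Query a l r) x)"
      by (simp only:)
    then show ?thesis
      by simp
  qed
  also have "\<dots> \<le> 2 ^ depth l * M + 2 ^ depth r * M"
    using Query.prems affine_halfspace by (intro add_mono Query.IH) blast+
  also have "\<dots> \<le> 2 ^ max (depth l) (depth r) * M + 2 ^ max (depth l) (depth r) * M"
    using \<open>M \<ge> 0\<close> by (intro add_mono mult_right_mono power_increasing) auto
  finally show ?case
    by (simp add: mult_ac)
qed

lemma affine_cube: "affine_subspace n (cube n)"
  using cube_0 unfolding affine_subspace_iff by (metis cube_add empty_iff order_refl)

text \<open>The left side is the expected product of the signs of \<open>f\<close> and of the
  output: an input counts 1 if they agree and -1 otherwise.\<close>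

lemma tree_error_ge:
  assumes supp: "set_pmf \<mu> \<subseteq> cube n"
    and M: "\<And>S. affine_subspace n S \<Longrightarrow> \<bar>\<Sum>x\<in>S. sgnb (f x) * pmf \<mu> x\<bar> \<le> M" and "M \<ge> 0"
  shows "1 - 2 * measure_pmf.prob \<mu> {x. eval_tree n T x \<noteq> f x} \<le> 2 ^ depth T * M"
proof -
  let ?E = "{x. eval_tree n T x \<noteq> f x}"
  have one: "(\<Sum>x\<in>cube n. pmf \<mu> x) = 1"
    using supp by (intro sum_pmf_eq_1) auto
  have "measure_pmf.prob \<mu> ?E = measure_pmf.prob \<mu> (cube n \<inter> ?E)"
    using supp by (intro measure_pmf.finite_measure_eq_AE) (auto simp: AE_measure_pmf_iff)
  also have "\<dots> = (\<Sum>x\<in>cube n \<inter> ?E. pmf \<mu> x)"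
    by (simp add: measure_measure_pmf_finite)
  also have "\<dots> = (\<Sum>x\<in>cube n. if x \<in> ?E then pmf \<mu> x else 0)"
    by (rule sum.inter_restrict) simp
  finally have "1 - 2 * measure_pmf.prob \<mu> ?E
      = (\<Sum>x\<in>cube n. pmf \<mu> x - 2 * (if x \<in> ?E then pmf \<mu> x else 0))"
    by (simp add: sum_subtractf sum_distrib_left one)
  also have "\<dots> = (\<Sum>x\<in>cube n. sgnb (f x) * sgnb (eval_tree n T x) * pmf \<mu> x)"
    by (intro sum.cong refl) (auto simp: sgnb_def)
  also have "\<dots> \<le> 2 ^ depth T * M"
    using affine_cube by (intro tree_correlation_le M \<open>M \<ge> 0\<close>) auto
  finally show ?thesis .
qed

section \<open>Trees under partial fixings\<close>

text \<open>All points consistent with \<open>H\<close> agree on every query in the span, so any one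
  of them determines the forced answer. Hence \<open>prune\<close> follows the branch that
  \<open>x\<close> itself would take.\<close>

lemma forced_span:
  assumes a: "a \<in> F2.span (fst ` H)" and x: "x \<in> cube n" "\<forall>(c, d)\<in>H. ip n c x = d"
  shows "forced n H a b \<longleftrightarrow> ip n a x = b"
proof -
  have *: "ip n a y = ip n a x" if y: "y \<in> cube n" "\<forall>(c, d)\<in>H. ip n c y = d" for y
  proof -
    let ?U = "{a. ip n a y = ip n a x}"
    have U: "F2.subspace ?U"
      unfolding F2.subspace_def
      by (auto simp: ip_add_left) (auto simp: ip_def scale_vec_def mult.assoc simp flip: sum_distrib_left)
    have "ip n c y = ip n c x" if "(c, d) \<in> H" for c d
      using x(2) y(2) that by (auto dest!: bspec)
    then have "F2.span (fst ` H) \<subseteq> ?U"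
      using U by (intro F2.span_minimal) auto
    then show ?thesis
      using a by blast
  qed
  show ?thesis
    unfolding forced_def using * x by metis
qed

lemma eval_prune:
  assumes "x \<in> cube n" "\<forall>(c, d)\<in>H. ip n c x = d"
  shows "eval_tree n (prune n H T) x = eval_tree n T x"
  using assms by (induction T arbitrary: H) (auto simp: forced_span[of _ _ x])

definition subcube :: "nat \<Rightarrow> (nat \<Rightarrow> bool) \<Rightarrow> (nat \<Rightarrow> bit) set" where
  "subcube n \<rho> = {x \<in> cube n. \<forall>i<n. \<not> \<rho> i \<longrightarrow> x i = 0}"

lemma subcube_cube: "x \<in> subcube n \<rho> \<Longrightarrow> x \<in> cube n"
  by (simp add: subcube_def)

lemma ip_restrict:
  "x \<in> subcube n \<rho> \<Longrightarrow> ip n (\<lambda>i. if \<rho> i then a i else 0) x = ip n a x"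
  unfolding ip_def by (intro sum.cong) (auto simp: subcube_def)

lemma eval_fix_zeros:
  "x \<in> subcube n \<rho> \<Longrightarrow> eval_tree n (fix_zeros \<rho> T) x = eval_tree n T x"
  by (induction T) (auto simp: ip_restrict)

lemma eval_apply_fixing:
  "x \<in> subcube n \<rho> \<Longrightarrow> eval_tree n (apply_fixing n \<rho> T) x = eval_tree n T x"
  by (simp add: apply_fixing_def eval_prune eval_fix_zeros subcube_cube)

text \<open>A bound on the cost after a fixing that avoids spans: a query counts as soon as it
  involves a free coordinate, even if it depends linearly on earlier ones.\<close>

fun live_queries :: "nat \<Rightarrow> (nat \<Rightarrow> bool) \<Rightarrow> ptree \<Rightarrow> (nat \<Rightarrow> bit) \<Rightarrow> nat" where
  "live_queries n \<rho> (Leaf b) x = 0"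
| "live_queries n \<rho> (Query a l r) x =
     of_bool (\<exists>u. \<rho> u \<and> a u \<noteq> 0) +
     (if ip n a x = 0 then live_queries n \<rho> l x else live_queries n \<rho> r x)"

text \<open>A query kept by \<open>prune\<close> lies outside a span, so its restriction to the free
  coordinates is nonzero and \<open>live_queries\<close> counts it.\<close>

lemma queries_prune_le:
  assumes "x \<in> subcube n \<rho>" "\<forall>(c, d)\<in>H. ip n c x = d"
  shows "queries n (prune n H (fix_zeros \<rho> T)) x \<le> live_queries n \<rho> T x"
  using assms(2)
proof (induction T arbitrary: H)
  case (Query a l r)
  let ?a = "\<lambda>i. if \<rho> i then a i else 0"
  have ip_a: "ip n ?a x = ip n a x"
    using assms(1) by (rule ip_restrict)
  show ?case
  proof (cases "?a \<in> F2.span (fst ` H)")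
    case True
    then have "forced n H ?a 0 \<longleftrightarrow> ip n a x = 0"
      using forced_span[OF True _ Query.prems] subcube_cube[OF assms(1)] ip_a by simp
    then show ?thesis
      using True Query.IH[OF Query.prems] by (auto intro: le_SucI)
  next
    case False
    then have "?a \<noteq> 0"
      using F2.span_zero by metis
    then have live: "\<exists>u. \<rho> u \<and> a u \<noteq> 0"
      by (auto simp: fun_eq_iff split: if_splits)
    have "queries n (prune n (insert (?a, 0) H) (fix_zeros \<rho> l)) x \<le> live_queries n \<rho> l x"
      if "ip n a x = 0"
      using Query.prems that ip_a by (intro Query.IH) auto
    moreover have "queries n (prune n (insert (?a, 1) H) (fix_zeros \<rho> r)) x \<le> live_queries n \<rho> r x"
      if "ip n a x = 1"
      using Query.prems that ip_a by (intro Query.IH) auto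
    ultimately show ?thesis
      using False live ip_a by simp
  qed
qed simp

lemma queries_apply_fixing_le:
  "x \<in> subcube n \<rho> \<Longrightarrow> queries n (apply_fixing n \<rho> T) x \<le> live_queries n \<rho> T x"
  unfolding apply_fixing_def by (rule queries_prune_le) auto

text \<open>The continuation \<open>c\<close> receives the values read, recorded as updates of
  \<open>s\<close>, so that the rest of the tree can depend on them.\<close>

fun read_coords :: "nat list \<Rightarrow> ((nat \<Rightarrow> bit) \<Rightarrow> ptree) \<Rightarrow> (nat \<Rightarrow> bit) \<Rightarrow> ptree" where
  "read_coords [] c s = c s"
| "read_coords (u # us) c s =
     Query (unit_vec u) (read_coords us c (s(u := 0))) (read_coords us c (s(u := 1)))"

lemma ptree_on_read_coords:
  "set us \<subseteq> {..<n} \<Longrightarrow> (\<And>s. ptree_on n (c s)) \<Longrightarrow> ptree_on n (read_coords us c s)"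
  by (induction us arbitrary: s) auto

lemma eval_read_coords:
  "set us \<subseteq> {..<n} \<Longrightarrow>
     eval_tree n (read_coords us c s) x = eval_tree n (c (override_on s x (set us))) x"
proof (induction us arbitrary: s)
  case (Cons u us)
  then show ?case
    by (cases "x u") (auto simp: override_on_insert')
qed simp

lemma depth_read_coords:
  "(\<And>s. depth (c s) \<le> d) \<Longrightarrow> depth (read_coords us c s) \<le> length us + d"
  by (induction us arbitrary: s) auto

lemma live_queries_read_coords:
  assumes "set us \<subseteq> {..<n}" "distinct us"
  shows "live_queries n \<rho> (read_coords us c s) x =
     (\<Sum>u\<in>set us. of_bool (\<rho> u)) + live_queries n \<rho> (c (override_on s x (set us))) x"
  using assms
proof (induction us arbitrary: s)
  case (Cons u us)
  have "(\<exists>v. \<rho> v \<and> unit_vec u v \<noteq> 0) \<longleftrightarrow> \<rho> u"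
    by (auto simp: unit_vec_def)
  with Cons show ?case
    by (cases "x u") (auto simp: override_on_insert' simp del: bit_not_zero_iff)
qed simp

section \<open>The block function and two trees that compute it\<close>

locale block_fn =
  fixes k t :: nat
begin

definition blk :: "nat \<Rightarrow> nat set" where
  "blk j = {j * 2 ^ k..<Suc j * 2 ^ k}"

text \<open>The blocks fill the indices below \<open>off\<close>; the \<open>k\<close> bits
  \<open>y\<close> start at \<open>off\<close>.\<close>

definition off :: nat where
  "off = t * 2 ^ k"

definition par :: "nat \<Rightarrow> (nat \<Rightarrow> bit) \<Rightarrow> bit" where
  "par j z = (\<Sum>u\<in>blk j. z u)"

text \<open>The sum of expansions is stored at the coordinates of \<open>y\<close>, so an inner
  product with the whole input sees only \<open>y\<close>. Blocks start at multiples of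
  \<open>2 ^ k\<close>, so the low \<open>k\<close> bits of an index \<open>u\<close> give its
  position within its block.\<close>

definition sel :: "nat \<Rightarrow> (nat \<Rightarrow> bit) \<Rightarrow> nat \<Rightarrow> bit" where
  "sel j z = (\<lambda>v. if v \<in> {off..<off + k} then \<Sum>u\<in>blk j. z u * of_bool (bit u (v - off)) else 0)"

primrec h :: "nat \<Rightarrow> (nat \<Rightarrow> bit) \<Rightarrow> nat \<Rightarrow> bit" where
  "h 0 z = unit_vec off"
| "h (Suc j) z = (if par j z = 1 then sel j z else h j z)"

definition f :: "nat \<Rightarrow> (nat \<Rightarrow> bit) \<Rightarrow> bit" where
  "f n z = ip n (h t z) z"

lemma finite_blk [simp]: "finite (blk j)"
  by (simp add: blk_def)

lemma card_blk: "card (blk j) = 2 ^ k"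
  by (simp add: blk_def)

lemma blk_subset: "j < t \<Longrightarrow> blk j \<subseteq> {..<off}"
proof -
  assume "j < t"
  then have "Suc j * 2 ^ k \<le> off"
    unfolding off_def by (intro mult_right_mono) auto
  then show ?thesis
    by (auto simp: blk_def)
qed

lemma mem_blk_iff: "u \<in> blk j \<longleftrightarrow> u div 2 ^ k = j"
proof -
  have "u div 2 ^ k = j \<longleftrightarrow> j \<le> u div 2 ^ k \<and> u div 2 ^ k < Suc j"
    by auto
  also have "\<dots> \<longleftrightarrow> u \<in> blk j"
    by (auto simp: blk_def less_eq_div_iff_mult_less_eq div_less_iff_less_mult simp del: mult_Suc)
  finally show ?thesis ..
qed

lemma par_cong: "(\<And>u. u \<in> blk j \<Longrightarrow> z u = z' u) \<Longrightarrow> par j z = par j z'"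
  unfolding par_def by (rule sum.cong) auto

lemma sel_cong: "(\<And>u. u \<in> blk j \<Longrightarrow> z u = z' u) \<Longrightarrow> sel j z = sel j z'"
  unfolding sel_def by (intro ext if_cong sum.cong refl) auto

lemma h_cong: "j \<le> t \<Longrightarrow> (\<And>u. u < off \<Longrightarrow> z u = z' u) \<Longrightarrow> h j z = h j z'"
proof (induction j)
  case (Suc j)
  have "z u = z' u" if "u \<in> blk j" for u
    using Suc.prems that blk_subset[of j] by auto
  then have "par j z = par j z'" "sel j z = sel j z'"
    by (auto intro: par_cong sel_cong)
  then show ?case
    using Suc by simp
qed simp

lemma h_coord_space: "k > 0 \<Longrightarrow> h j z \<in> coord_space {off..<off + k}"
  by (induction j) (auto simp: coord_space_def unit_vec_def sel_def)

lemma h_zero: "h j 0 = unit_vec off"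
  by (induction j) (auto simp: par_def)

lemma ip_sel:
  assumes "off + k \<le> n"
  shows "ip n (sel j z) x = (\<Sum>b<k. (\<Sum>u\<in>blk j. z u * of_bool (bit u b)) * x (off + b))"
proof -
  have "ip n (sel j z) x = (\<Sum>v\<in>{off..<off + k}. sel j z v * x v)"
    unfolding ip_def using assms by (intro sum.mono_neutral_right) (auto simp: sel_def)
  also have "\<dots> = (\<Sum>b<k. sel j z (off + b) * x (off + b))"
    by (intro sum.reindex_bij_witness[of _ "\<lambda>b. off + b" "\<lambda>v. v - off"]) auto
  finally show ?thesis
    by (simp add: sel_def)
qed

text \<open>The tree that is cheap on average: it reads blocks from the last one down, and the first
  flagged one determines a final parity query on \<open>y\<close>. With no flagged block left,
  \<open>sweep 0\<close> queries the default vector.\<close>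

primrec sweep :: "nat \<Rightarrow> ptree" where
  "sweep 0 = Query (unit_vec off) (Leaf 0) (Leaf 1)"
| "sweep (Suc j) = read_coords [j * 2 ^ k..<Suc j * 2 ^ k]
     (\<lambda>s. if par j s = 1 then Query (sel j s) (Leaf 0) (Leaf 1) else sweep j) 0"

text \<open>The shallow tree, where \<open>s\<close> holds the bits \<open>y\<close> read
  beforehand. A block parity is one query, and by bilinearity the value given by a flagged block is
  one parity of that block with coefficients computed from \<open>s\<close>.\<close>

primrec probe :: "nat \<Rightarrow> (nat \<Rightarrow> bit) \<Rightarrow> ptree" where
  "probe 0 s = Leaf (s off)"
| "probe (Suc j) s = Query (\<lambda>u. of_bool (u \<in> blk j)) (probe j s)
     (Query (\<lambda>u. if u \<in> blk j then \<Sum>b<k. of_bool (bit u b) * s (off + b) else 0) (Leaf 0) (Leaf 1))"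

end

locale block_fn_fit = block_fn +
  fixes n :: nat
  assumes k_pos: "k > 0" and fit: "off + k \<le> n"
begin

lemma blk_n: "j < t \<Longrightarrow> u \<in> blk j \<Longrightarrow> u < n"
  using blk_subset[of j] fit by auto

lemma sel_cube: "sel j z \<in> cube n"
  using fit by (auto simp: sel_def cube_def)

lemma ptree_on_sweep: "j \<le> t \<Longrightarrow> ptree_on n (sweep j)"
proof (induction j)
  case 0
  then show ?case
    using fit k_pos by simp
next
  case (Suc j)
  then show ?case
    using blk_n[of j] sel_cube
    unfolding sweep.simps by (intro ptree_on_read_coords) (auto simp: blk_def)
qed

lemma eval_sweep: "j \<le> t \<Longrightarrow> eval_tree n (sweep j) x = ip n (h j x) x"
proof (induction j)
  case 0
  then show ?case
    using fit k_pos by (cases "x off") auto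
next
  case (Suc j)
  let ?s = "override_on 0 x (blk j)"
  have "par j ?s = par j x" "sel j ?s = sel j x"
    by (intro par_cong sel_cong, simp)+
  moreover have "set [j * 2 ^ k..<Suc j * 2 ^ k] = blk j"
    by (simp add: blk_def)
  moreover have "blk j \<subseteq> {..<n}"
    using blk_n[of j] Suc.prems by auto
  ultimately show ?case
    using Suc unfolding sweep.simps by (subst eval_read_coords) (auto simp del: upt_Suc mult_Suc)
qed

text \<open>Block \<open>i\<close> is reached only if all later blocks have parity 0, and reading it
  costs its number of stars. The leading 1 pays for the final query on \<open>y\<close>.\<close>

lemma live_queries_sweep:
  assumes "j \<le> t"
  shows "live_queries n \<rho> (sweep j) x \<le>
     1 + (\<Sum>i<j. of_bool (\<forall>l\<in>{i<..<j}. par l x = 0) * (\<Sum>u\<in>blk i. of_bool (\<rho> u)))"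
  using assms
proof (induction j)
  case (Suc j)
  let ?s = "override_on 0 x (blk j)"
  let ?stars = "\<lambda>i. (\<Sum>u\<in>blk i. of_bool (\<rho> u)) :: nat"
  have par: "par j ?s = par j x"
    by (rule par_cong) simp
  have "set [j * 2 ^ k..<Suc j * 2 ^ k] = blk j" "blk j \<subseteq> {..<n}"
    using blk_n[of j] Suc.prems by (auto simp: blk_def)
  then have "live_queries n \<rho> (sweep (Suc j)) x = ?stars j +
      (if par j x = 1 then live_queries n \<rho> (Query (sel j ?s) (Leaf 0) (Leaf 1)) x
       else live_queries n \<rho> (sweep j) x)"
    unfolding sweep.simps by (subst live_queries_read_coords) (auto simp: par simp del: upt_Suc mult_Suc)
  also have "\<dots> \<le> ?stars j + (1 + (\<Sum>i<j. of_bool (\<forall>l\<in>{i<..<Suc j}. par l x = 0) * ?stars i))"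
  proof (cases "par j x = 1")
    case False
    have "{i<..<Suc j} = insert j {i<..<j}" if "i < j" for i
      using that by auto
    then show ?thesis
      using Suc False by simp
  qed auto
  moreover have "{j<..<Suc j} = {}"
    by auto
  ultimately show ?case
    by simp
qed simp

lemma ptree_on_probe: "j \<le> t \<Longrightarrow> ptree_on n (probe j s)"
proof (induction j)
  case (Suc j)
  then show ?case
    using blk_n[of j] by (force simp: cube_def)
qed simp

lemma depth_probe: "depth (probe j s) \<le> Suc j"
  by (induction j) auto

lemma eval_probe:
  assumes "\<And>b. b < k \<Longrightarrow> s (off + b) = x (off + b)" and "j \<le> t"
  shows "eval_tree n (probe j s) x = ip n (h j x) x"
  using assms(2)
proof (induction j)
  case 0
  then show ?case
    using fit k_pos assms(1)[of 0] by simp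
next
  case (Suc j)
  have sub: "blk j \<subseteq> {..<n}"
    using blk_n[of j] Suc.prems by auto
  have "ip n (\<lambda>u. of_bool (u \<in> blk j)) x = (\<Sum>u\<in>blk j. of_bool (u \<in> blk j) * x u)"
    unfolding ip_def using sub by (intro sum.mono_neutral_right) auto
  then have par: "ip n (\<lambda>u. of_bool (u \<in> blk j)) x = par j x"
    by (simp add: par_def)
  have "ip n (\<lambda>u. if u \<in> blk j then \<Sum>b<k. of_bool (bit u b) * s (off + b) else 0) x
      = (\<Sum>u\<in>blk j. (\<Sum>b<k. of_bool (bit u b) * s (off + b)) * x u)"
    unfolding ip_def using sub by (intro sum.mono_neutral_cong_right) auto
  also have "\<dots> = (\<Sum>b<k. (\<Sum>u\<in>blk j. x u * of_bool (bit u b)) * x (off + b))"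
    unfolding sum_distrib_right by (subst sum.swap) (intro sum.cong refl, simp add: assms(1) mult_ac)
  also have "\<dots> = ip n (sel j x) x"
    using fit by (rule ip_sel[symmetric])
  finally have sel: "ip n (\<lambda>u. if u \<in> blk j then \<Sum>b<k. of_bool (bit u b) * s (off + b) else 0) x
      = ip n (sel j x) x" .
  show ?case
    using Suc by (simp add: par sel)
qed

text \<open>Reading \<open>y\<close> takes \<open>k\<close> queries, followed by at most
  \<open>t\<close> block parities and one last parity. The tree gives the upper bounds on both the
  depth and, through \<open>tree_error_ge\<close>, the discrepancy.\<close>

lemma exact_shallow_tree:
  obtains T where "ptree_on n T" "depth T \<le> k + Suc t" "\<And>x. eval_tree n T x = f n x"
proof
  let ?T = "read_coords [off..<off + k] (probe t) 0"
  show "ptree_on n ?T"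
    using fit ptree_on_probe by (intro ptree_on_read_coords) auto
  show "depth ?T \<le> k + Suc t"
    using depth_read_coords[of "probe t" "Suc t" "[off..<off + k]"] depth_probe by simp
  show "eval_tree n ?T x = f n x" for x
    using fit unfolding f_def by (subst eval_read_coords) (auto intro!: eval_probe)
qed

end

section \<open>Parities of blocks under product distributions\<close>

text \<open>Writes a factor at \<open>r\<close> times products over disjoint blocks as a single
  product over all coordinates, the form to which independence applies.\<close>

lemma prod_blocks:
  fixes \<beta> :: "'a \<Rightarrow> real"
  assumes A: "finite A" "r \<in> A" and X: "finite X" "\<And>j. j \<in> X \<Longrightarrow> B j \<subseteq> A - {r}"
    and disj: "\<And>i j. i \<in> X \<Longrightarrow> j \<in> X \<Longrightarrow> i \<noteq> j \<Longrightarrow> B i \<inter> B j = {}"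
  shows "(\<Prod>u\<in>A. if u = r then \<alpha> else if u \<in> (\<Union>j\<in>X. B j) then \<beta> u else 1)
           = \<alpha> * (\<Prod>j\<in>X. \<Prod>u\<in>B j. \<beta> u)"
proof -
  have fin: "finite (B j)" if "j \<in> X" for j
    using A(1) X(2)[OF that] finite_subset by blast
  have "(\<Prod>j\<in>X. \<Prod>u\<in>B j. \<beta> u) = (\<Prod>u\<in>(\<Union>j\<in>X. B j). \<beta> u)"
    using X(1) fin disj by (intro prod.UNION_disjoint[symmetric]) auto
  also have "\<dots> = (\<Prod>u\<in>A - {r}. if u = r then \<alpha> else if u \<in> (\<Union>j\<in>X. B j) then \<beta> u else 1)"
    using A X by (intro prod.mono_neutral_cong_left) auto
  finally show ?thesis
    using A by (subst prod.remove[of _ r]) auto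
qed

text \<open>Coordinates are independent, and finite supports make factors of either sign
  integrable.\<close>

lemma expectation_prod_Pi_pmf_signed:
  fixes g :: "'a \<Rightarrow> 'b \<Rightarrow> real"
  assumes A: "finite A" and fin: "\<And>u. u \<in> A \<Longrightarrow> finite (set_pmf (P u))"
  shows "measure_pmf.expectation (Pi_pmf A d P) (\<lambda>z. \<Prod>u\<in>A. g u (z u))
           = (\<Prod>u\<in>A. measure_pmf.expectation (P u) (g u))"
proof -
  let ?M = "Pi_pmf A d P"
  have finM: "finite (set_pmf ?M)"
    using A fin by (simp add: set_Pi_pmf finite_PiE_dflt)
  have "prob_space.indep_vars (measure_pmf ?M) (\<lambda>_. borel) (\<lambda>u z. g u (z u)) A"
    by (rule prob_space.indep_vars_compose2[OF measure_pmf.prob_space_axioms indep_vars_Pi_pmf[OF A]]) simp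
  then have "measure_pmf.expectation ?M (\<lambda>z. \<Prod>u\<in>A. g u (z u))
      = (\<Prod>u\<in>A. measure_pmf.expectation ?M (\<lambda>z. g u (z u)))"
    using A finM by (intro prob_space.indep_vars_lebesgue_integral measure_pmf.prob_space_axioms integrable_measure_pmf_finite)
  also have "\<dots> = (\<Prod>u\<in>A. measure_pmf.expectation (P u) (g u))"
  proof (intro prod.cong refl)
    fix u assume "u \<in> A"
    then have "P u = map_pmf (\<lambda>z. z u) ?M"
      using Pi_pmf_component[OF A, of u d P] by simp
    then show "measure_pmf.expectation ?M (\<lambda>z. g u (z u)) = measure_pmf.expectation (P u) (g u)"
      by simp
  qed
  finally show ?thesis .
qed

text \<open>
  With \<open>g\<close> the sign of a bit, \<open>(1 + (\<Prod>u\<in>B j. g u (z u))) / 2\<close> is the indicator of the event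
  that the parity of the block \<open>B j\<close> vanishes.
\<close>

lemma expectation_block_product:
  fixes g :: "'a \<Rightarrow> 'b \<Rightarrow> real" and c :: "'b \<Rightarrow> real"
  assumes A: "finite A" "r \<in> A" and fin: "\<And>u. u \<in> A \<Longrightarrow> finite (set_pmf (P u))"
    and J: "finite J" "\<And>j. j \<in> J \<Longrightarrow> B j \<subseteq> A - {r}"
    and disj: "\<And>i j. i \<in> J \<Longrightarrow> j \<in> J \<Longrightarrow> i \<noteq> j \<Longrightarrow> B i \<inter> B j = {}"
  shows "measure_pmf.expectation (Pi_pmf A d P)
           (\<lambda>z. c (z r) * (\<Prod>j\<in>J. (1 + (\<Prod>u\<in>B j. g u (z u))) / 2))
         = measure_pmf.expectation (P r) c *
           (\<Prod>j\<in>J. (1 + (\<Prod>u\<in>B j. measure_pmf.expectation (P u) (g u))) / 2)"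
proof -
  let ?E = "measure_pmf.expectation (Pi_pmf A d P)"
  let ?e = "\<lambda>u. measure_pmf.expectation (P u)"
  have finM: "finite (set_pmf (Pi_pmf A d P))"
    using A fin by (simp add: set_Pi_pmf finite_PiE_dflt)
  \<comment> \<open>Expanding over the subsets \<open>X\<close> of \<open>J\<close> leaves products
    of functions of distinct coordinates, whose expectations factor.\<close>
  have expand: "\<alpha> * (\<Prod>j\<in>J. (1 + b j) / 2) = (\<Sum>X\<in>Pow J. \<alpha> * (\<Prod>j\<in>X. b j)) / 2 ^ card J"
    for \<alpha> :: real and b :: "'c \<Rightarrow> real"
    using prod_add[OF J(1), of b "\<lambda>_. 1"]
    by (simp add: prod_dividef sum_distrib_left add.commute)
  have summand: "?E (\<lambda>z. c (z r) * (\<Prod>j\<in>X. \<Prod>u\<in>B j. g u (z u)))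
      = ?e r c * (\<Prod>j\<in>X. \<Prod>u\<in>B j. ?e u (g u))" if "X \<in> Pow J" for X
  proof -
    have "X \<subseteq> J"
      using that by simp
    then have X: "\<And>j. j \<in> X \<Longrightarrow> B j \<subseteq> A - {r}"
      "\<And>i j. i \<in> X \<Longrightarrow> j \<in> X \<Longrightarrow> i \<noteq> j \<Longrightarrow> B i \<inter> B j = {}"
      using J(2) disj by (simp_all add: subset_eq[of X])
    have "finite X"
      using \<open>X \<subseteq> J\<close> J(1) by (rule finite_subset)
    note X = this X
    let ?G = "\<lambda>u y. if u = r then c y else if u \<in> (\<Union>j\<in>X. B j) then g u y else 1"
    have "?E (\<lambda>z. c (z r) * (\<Prod>j\<in>X. \<Prod>u\<in>B j. g u (z u))) = ?E (\<lambda>z. \<Prod>u\<in>A. ?G u (z u))"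
      by (intro arg_cong[of _ _ ?E] ext, subst prod_blocks[OF A X, symmetric])
         (auto intro!: prod.cong)
    also have "\<dots> = (\<Prod>u\<in>A. ?e u (?G u))"
      by (rule expectation_prod_Pi_pmf_signed[OF A(1) fin])
    also have "\<dots> = (\<Prod>u\<in>A. if u = r then ?e r c else if u \<in> (\<Union>j\<in>X. B j) then ?e u (g u) else 1)"
      by (intro prod.cong) auto
    also have "\<dots> = ?e r c * (\<Prod>j\<in>X. \<Prod>u\<in>B j. ?e u (g u))"
      by (rule prod_blocks[OF A X])
    finally show ?thesis .
  qed
  have "?E (\<lambda>z. c (z r) * (\<Prod>j\<in>J. (1 + (\<Prod>u\<in>B j. g u (z u))) / 2))
      = (\<Sum>X\<in>Pow J. ?E (\<lambda>z. c (z r) * (\<Prod>j\<in>X. \<Prod>u\<in>B j. g u (z u)))) / 2 ^ card J"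
    unfolding expand using finM
    by (simp add: Bochner_Integration.integral_sum integrable_measure_pmf_finite)
  also have "\<dots> = ?e r c * (\<Prod>j\<in>J. (1 + (\<Prod>u\<in>B j. ?e u (g u))) / 2)"
    unfolding expand using summand by simp
  finally show ?thesis .
qed

lemma expectation_bernoulli_pmf:
  fixes g :: "bool \<Rightarrow> real"
  assumes "0 \<le> p" "p \<le> 1"
  shows "measure_pmf.expectation (bernoulli_pmf p) g = p * g True + (1 - p) * g False"
  using assms by (simp add: mult.commute)

lemma finite_set_pmf_bit [simp]: "finite (set_pmf (P :: bit pmf))"
  by (rule finite_subset[OF subset_UNIV], subst UNIV_bit) simp

text \<open>The subcube is a product set, so its uniform distribution has independent coordinates
  and \<open>expectation_block_product\<close> applies to it.\<close>

lemma unif_fixing_eq: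
  "unif_fixing n \<rho> = Pi_pmf {..<n} 0 (\<lambda>u. pmf_of_set (if \<rho> u then {0, 1} else {0 :: bit}))"
proof -
  have "{x \<in> cube n. \<forall>i<n. \<not> \<rho> i \<longrightarrow> x i = 0} = PiE_dflt {..<n} 0 (\<lambda>u. if \<rho> u then {0, 1} else {0 :: bit})"
    by (auto simp: cube_def PiE_dflt_def not_less split: if_splits simp del: bit_not_zero_iff bit_not_one_iff)
       (metis UNIV_I UNIV_bit insertE singletonD)+
  then show ?thesis
    unfolding unif_fixing_def by (subst Pi_pmf_of_set) auto
qed

lemma subcube_finite: "finite (subcube n \<rho>)"
  by (rule finite_subset[OF _ finite_cube[of n]]) (auto simp: subcube_def)

lemma subcube_0: "0 \<in> subcube n \<rho>"
  by (simp add: subcube_def)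

lemma set_unif_fixing [simp]: "set_pmf (unif_fixing n \<rho>) = subcube n \<rho>"
  using subcube_finite[of n \<rho>] subcube_0[of n \<rho>]
  unfolding unif_fixing_def subcube_def[symmetric] by (intro set_pmf_of_set) auto

section \<open>The input distribution and the probability of a flag\<close>

context block_fn
begin

lemma blk_disjoint: "i \<noteq> j \<Longrightarrow> blk i \<inter> blk j = {}"
  by (auto simp: mem_blk_iff)

lemma parity_zero_indicator:
  assumes "finite J"
  shows "(of_bool (\<forall>l\<in>J. par l z = 0) :: real) = (\<Prod>l\<in>J. (1 + (\<Prod>u\<in>blk l. sgnb (z u))) / 2)"
proof -
  have *: "(1 + (\<Prod>u\<in>blk l. sgnb (z u))) / 2 = (of_bool (par l z = 0) :: real)" for l
    by (cases "par l z = 0") (auto simp: par_def simp flip: sgnb_sum)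
  show ?thesis
    unfolding * using assms by (induction J rule: finite_induct) auto
qed

text \<open>The probability that a block coordinate is a star; a block of \<open>2 ^ k\<close>
  coordinates thus has one star on average.\<close>

definition \<delta> :: real where
  "\<delta> = 1 / 2 ^ k"

text \<open>Half the star probability of a coordinate. Coordinates from \<open>off + k\<close> on
  are padding and constantly 0.\<close>

definition p :: "nat \<Rightarrow> real" where
  "p u = (if u < off then \<delta> / 2 else if u < off + k then 1 / 2 else 0)"

definition mu :: "nat \<Rightarrow> (nat \<Rightarrow> bit) pmf" where
  "mu n = Pi_pmf {..<n} 0 (\<lambda>u. map_pmf of_bool (bernoulli_pmf (p u)))"

text \<open>The probability that a block has parity 0, as the sign of each of its bits has mean
  \<open>1 - \<delta>\<close>.\<close>

definition q :: real where
  "q = (1 + (1 - \<delta>) ^ 2 ^ k) / 2"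

lemma delta_bounds: "0 < \<delta>" "\<delta> \<le> 1"
  by (simp_all add: \<delta>_def)

lemma p_bounds: "0 \<le> p u" "p u \<le> 1 / 2"
  using delta_bounds by (auto simp: p_def)

text \<open>With \<open>N = 2 ^ k\<close>, the constant comes from
  \<open>(1 - 1 / N) ^ N \<le> exp (-1) \<le> 1 / 2\<close>.\<close>

lemma q_bounds: "0 \<le> q" "q \<le> 3 / 4"
proof -
  have "(1 - \<delta>) ^ 2 ^ k = (1 + (-1) / real (2 ^ k)) ^ 2 ^ k"
    by (simp add: \<delta>_def)
  also have "\<dots> \<le> exp (-1)"
    by (rule exp_ge_one_plus_x_over_n_power_n) auto
  also have "exp (-1 :: real) \<le> 1 / 2"
    using exp_ge_add_one_self[of "1 :: real"] by (simp add: exp_minus field_simps)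
  finally show "q \<le> 3 / 4"
    by (simp add: q_def)
  show "0 \<le> q"
    using delta_bounds by (simp add: q_def)
qed

lemma product_dist_mu: "product_dist n (mu n)"
  unfolding product_dist_def mu_def using p_bounds
  by (intro exI[of _ p]) (auto intro: order.trans[of _ "1 / 2"])

lemma mu_component:
  assumes "u < n"
  shows "map_pmf (\<lambda>z. z u) (mu n) = map_pmf of_bool (bernoulli_pmf (p u))"
  unfolding mu_def using assms by (subst Pi_pmf_component) auto

lemma prob_mu_component:
  assumes "u < n"
  shows "measure_pmf.prob (mu n) {z. z u = 1} = p u" "measure_pmf.prob (mu n) {z. z u = 0} = 1 - p u"
proof -
  have *: "measure_pmf.prob (mu n) {z. z u = b} = measure_pmf.prob (bernoulli_pmf (p u)) {c. of_bool c = b}" for b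
  proof -
    have "measure_pmf.prob (mu n) {z. z u = b} = measure_pmf.prob (map_pmf (\<lambda>z. z u) (mu n)) {b}"
      by (simp add: vimage_def)
    then show ?thesis
      by (simp add: mu_component[OF assms] vimage_def)
  qed
  have "{c. of_bool c = (1 :: bit)} = {True}" "{c. of_bool c = (0 :: bit)} = {False}"
    by auto
  then show "measure_pmf.prob (mu n) {z. z u = 1} = p u" "measure_pmf.prob (mu n) {z. z u = 0} = 1 - p u"
    using p_bounds[of u] by (simp_all add: * measure_pmf_single)
qed

lemma zero_biased_mu: "zero_biased n (mu n)"
  unfolding zero_biased_def
proof (intro conjI allI impI)
  fix u assume "u < n"
  then show "measure_pmf.prob (mu n) {x. x u = 0} \<ge> 1 / 2"
    using p_bounds(2)[of u] prob_mu_component(2)[of u n] by linarith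
qed (rule product_dist_mu)

lemma random_fixing_mu: "random_fixing n (mu n) = Pi_pmf {..<n} False (\<lambda>u. bernoulli_pmf (2 * p u))"
  unfolding random_fixing_def star_prob_def
  by (intro Pi_pmf_cong refl) (simp add: prob_mu_component)

lemma pmf_mu: "z \<in> cube n \<Longrightarrow> pmf (mu n) z = (\<Prod>u<n. if z u = 1 then p u else 1 - p u)"
  unfolding mu_def
proof (subst pmf_Pi')
  have "pmf (map_pmf of_bool (bernoulli_pmf (p u))) b = (if b = 1 then p u else 1 - p u)" for u and b :: bit
  proof -
    have "of_bool -` {b} = {b = (1 :: bit)}"
      by (cases b) auto
    then show ?thesis
      using p_bounds[of u] by (simp add: pmf_map measure_pmf_single)
  qed
  then show "(\<Prod>u<n. pmf (map_pmf of_bool (bernoulli_pmf (p u))) (z u)) = (\<Prod>u<n. if z u = 1 then p u else 1 - p u)"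
    by simp
qed (auto simp: cube_def)

lemma pmf_mu_outside: "z \<notin> cube n \<Longrightarrow> pmf (mu n) z = 0"
  unfolding mu_def by (rule pmf_Pi_outside) (force simp: cube_def not_less)+

lemma set_mu: "set_pmf (mu n) \<subseteq> cube n"
  by (metis pmf_mu_outside set_pmf_iff subsetI)

end

context block_fn_fit
begin

lemma coord_space_fit: "{off..<off + k} \<subseteq> {..<n}"
  using fit by auto

text \<open>The bits \<open>y\<close> are uniform, so flipping any of them preserves the
  mass.\<close>

lemma pmf_mu_shift:
  assumes v: "v \<in> coord_space {off..<off + k}"
  shows "pmf (mu n) (z + v) = pmf (mu n) z"
proof -
  have v_cube: "v \<in> cube n"
    using v coord_space_cube[OF coord_space_fit] by blast
  show ?thesis
  proof (cases "z \<in> cube n")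
    case True
    have "(if (z + v) u = 1 then p u else 1 - p u) = (if z u = 1 then p u else 1 - p u)" for u
    proof (cases "u \<in> {off..<off + k}")
      case False
      then show ?thesis
        using v by (simp add: coord_space_def)
    qed (auto simp: p_def)
    then show ?thesis
      using True v_cube by (simp add: pmf_mu)
  next
    case False
    moreover have "z + v \<notin> cube n"
      using False v_cube cube_add[of "z + v" n v] by auto
    ultimately show ?thesis
      by (simp add: pmf_mu_outside)
  qed
qed

lemma prob_unflagged: "measure_pmf.prob (mu n) {z. \<forall>l<t. par l z = 0} = q ^ t"
proof -
  let ?P = "\<lambda>u. map_pmf of_bool (bernoulli_pmf (p u)) :: bit pmf"
  have B: "blk j \<subseteq> {..<n} - {off}" if "j \<in> {..<t}" for j
    using blk_subset[of j] that fit by auto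
  have sgn: "measure_pmf.expectation (?P u) sgnb = 1 - \<delta>" if "u < off" for u
    using that p_bounds[of u] by (simp add: p_def field_simps)
  have "measure_pmf.prob (mu n) {z. \<forall>l<t. par l z = 0}
      = measure_pmf.expectation (mu n) (\<lambda>z. of_bool (\<forall>l\<in>{..<t}. par l z = 0))"
  proof -
    have "indicator {z. \<forall>l<t. par l z = 0} = (\<lambda>z. of_bool (\<forall>l\<in>{..<t}. par l z = 0) :: real)"
      by (auto simp: indicator_def fun_eq_iff)
    moreover have "measure_pmf.prob (mu n) {z. \<forall>l<t. par l z = 0}
        = measure_pmf.expectation (mu n) (indicator {z. \<forall>l<t. par l z = 0})"
      by simp
    ultimately show ?thesis
      by (simp only:)
  qed
  also have "\<dots> = measure_pmf.expectation (mu n) (\<lambda>z. 1 * (\<Prod>l\<in>{..<t}. (1 + (\<Prod>u\<in>blk l. sgnb (z u))) / 2))"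
    by (subst parity_zero_indicator) auto
  \<comment> \<open>The extra factor is trivial here; \<open>off\<close> serves as a coordinate
    outside all blocks.\<close>
  also have "\<dots> = (\<Prod>l\<in>{..<t}. (1 + (\<Prod>u\<in>blk l. measure_pmf.expectation (?P u) sgnb)) / 2)"
    unfolding mu_def using B blk_disjoint k_pos fit
    by (subst expectation_block_product[where r = off and c = "\<lambda>_. 1"]) auto
  also have "\<dots> = (\<Prod>l\<in>{..<t}. q)"
  proof (intro prod.cong refl)
    fix l assume "l \<in> {..<t}"
    then have "(\<Prod>u\<in>blk l. measure_pmf.expectation (?P u) sgnb) = (\<Prod>u\<in>blk l. 1 - \<delta>)"
      using blk_subset[of l] by (intro prod.cong refl sgn) auto
    then show "(1 + (\<Prod>u\<in>blk l. measure_pmf.expectation (?P u) sgnb)) / 2 = q"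
      by (simp add: q_def card_blk)
  qed
  finally show ?thesis
    by simp
qed

text \<open>A free coordinate has mean sign 0 and a fixed one has sign 1. So a block with a star has
  parity 0 with probability 1/2, and a block without stars has parity 0 for certain.\<close>

lemma unif_fixing_unflagged:
  assumes "J \<subseteq> {..<t}"
  shows "measure_pmf.expectation (unif_fixing n \<rho>) (\<lambda>x. of_bool (\<forall>l\<in>J. par l x = 0))
           = (\<Prod>l\<in>J. (1 + (\<Prod>u\<in>blk l. of_bool (\<not> \<rho> u) :: real)) / 2)"
proof -
  let ?P = "\<lambda>u. pmf_of_set (if \<rho> u then {0, 1} else {0 :: bit})"
  have J: "finite J"
    using assms finite_subset by blast
  have B: "blk j \<subseteq> {..<n} - {off}" if "j \<in> J" for j
    using blk_subset[of j] that fit assms by fastforce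
  have sgn: "measure_pmf.expectation (?P u) sgnb = of_bool (\<not> \<rho> u)" for u
    by (subst integral_pmf_of_set) auto
  have "measure_pmf.expectation (unif_fixing n \<rho>) (\<lambda>x. of_bool (\<forall>l\<in>J. par l x = 0))
      = measure_pmf.expectation (unif_fixing n \<rho>) (\<lambda>z. 1 * (\<Prod>l\<in>J. (1 + (\<Prod>u\<in>blk l. sgnb (z u))) / 2))"
    using J by (subst parity_zero_indicator) auto
  also have "\<dots> = (\<Prod>l\<in>J. (1 + (\<Prod>u\<in>blk l. measure_pmf.expectation (?P u) sgnb)) / 2)"
    unfolding unif_fixing_eq using J B blk_disjoint k_pos fit
    by (subst expectation_block_product[where r = off and c = "\<lambda>_. 1"]) auto
  finally show ?thesis
    by (simp only: sgn)
qed

text \<open>As \<open>u\<close> lies outside the blocks in \<open>J\<close>, its star is independent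
  of them. A coordinate of such a block is fixed with probability \<open>1 - \<delta>\<close>, the
  mean sign of a bit under \<open>mu n\<close>, so each block contributes \<open>q\<close>
  again.\<close>

lemma expected_star_unflagged:
  assumes J: "J \<subseteq> {..<t}" and i: "i < t" "i \<notin> J" and u: "u \<in> blk i"
  shows "measure_pmf.expectation (random_fixing n (mu n)) (\<lambda>\<rho>. of_bool (\<rho> u) *
           measure_pmf.expectation (unif_fixing n \<rho>) (\<lambda>x. of_bool (\<forall>l\<in>J. par l x = 0))) = \<delta> * q ^ card J"
proof -
  let ?P = "\<lambda>u. bernoulli_pmf (2 * p u)"
  have finJ: "finite J"
    using J finite_subset by blast
  have u_off: "u < off"
    using u i blk_subset[of i] by auto
  have B: "blk j \<subseteq> {..<n} - {u}" if "j \<in> J" for j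
  proof -
    have "blk j \<subseteq> {..<off}" "u \<notin> blk j"
      using blk_subset[of j] blk_disjoint[of i j] u i that J by auto
    then show ?thesis
      using fit by auto
  qed
  have star: "measure_pmf.expectation (?P v) g = \<delta> * g True + (1 - \<delta>) * g False"
    if "v < off" for v and g :: "bool \<Rightarrow> real"
    using that delta_bounds by (subst expectation_bernoulli_pmf) (auto simp: p_def)
  have "measure_pmf.expectation (random_fixing n (mu n)) (\<lambda>\<rho>. of_bool (\<rho> u) *
           measure_pmf.expectation (unif_fixing n \<rho>) (\<lambda>x. of_bool (\<forall>l\<in>J. par l x = 0)))
      = measure_pmf.expectation (random_fixing n (mu n))
          (\<lambda>\<rho>. of_bool (\<rho> u) * (\<Prod>l\<in>J. (1 + (\<Prod>v\<in>blk l. of_bool (\<not> \<rho> v) :: real)) / 2))"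
    by (simp only: unif_fixing_unflagged[OF J])
  also have "\<dots> = measure_pmf.expectation (?P u) of_bool *
      (\<Prod>l\<in>J. (1 + (\<Prod>v\<in>blk l. measure_pmf.expectation (?P v) (\<lambda>b. of_bool (\<not> b)))) / 2)"
    unfolding random_fixing_mu using finJ B blk_disjoint u_off fit
    by (subst expectation_block_product[where r = u and c = of_bool and g = "\<lambda>_ b. of_bool (\<not> b)"]) auto
  also have "(\<Prod>l\<in>J. (1 + (\<Prod>v\<in>blk l. measure_pmf.expectation (?P v) (\<lambda>b. of_bool (\<not> b)))) / 2) = (\<Prod>l\<in>J. q)"
  proof (intro prod.cong refl)
    fix l assume "l \<in> J"
    then have "(\<Prod>v\<in>blk l. measure_pmf.expectation (?P v) (\<lambda>b. of_bool (\<not> b))) = (\<Prod>v\<in>blk l. 1 - \<delta>)"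
      using blk_subset[of l] J by (intro prod.cong refl, subst star) auto
    then show "(1 + (\<Prod>v\<in>blk l. measure_pmf.expectation (?P v) (\<lambda>b. of_bool (\<not> b)))) / 2 = q"
      by (simp add: q_def card_blk)
  qed
  also have "measure_pmf.expectation (?P u) of_bool = \<delta>"
    using u_off by (subst star) auto
  finally show ?thesis
    by simp
qed

end

section \<open>Complexity bounds for the block function\<close>

context block_fn
begin

text \<open>For \<open>c < 2 ^ k\<close> only the low \<open>k\<close> bits of an index change, so
  this is an involution that maps every block to itself.\<close>

definition translate :: "nat \<Rightarrow> nat \<Rightarrow> nat" where
  "translate c u = (if u < off then Bit_Operations.xor u c else u)"

text \<open>The amount by which \<open>translate c\<close> moves \<open>h\<close> on flagged
  inputs.\<close>

definition cvec :: "nat \<Rightarrow> nat \<Rightarrow> bit" where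
  "cvec c = (\<lambda>v. if v \<in> {off..<off + k} then of_bool (bit c (v - off)) else 0)"

lemma inj_on_cvec: "inj_on cvec {..<2 ^ k}"
proof (rule inj_onI)
  fix c d :: nat assume c: "c \<in> {..<2 ^ k}" and d: "d \<in> {..<2 ^ k}" and eq: "cvec c = cvec d"
  have "bit c b \<longleftrightarrow> bit d b" for b
  proof (cases "b < k")
    case True
    then show ?thesis
      using fun_cong[OF eq, of "off + b"] by (simp add: cvec_def of_bool_def split: if_splits)
  next
    case False
    have "take_bit k c = c" "take_bit k d = d"
      using c d by (simp_all add: take_bit_eq_mod)
    then show ?thesis
      using False by (metis bit_take_bit_iff)
  qed
  then show "c = d"
    by (rule bit_eqI)
qed

lemma xor_div_pow:
  "c < 2 ^ k \<Longrightarrow> Bit_Operations.xor u c div 2 ^ k = u div 2 ^ k" for u c :: nat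
  by (simp flip: drop_bit_eq_div) (simp add: drop_bit_eq_div)

lemma less_off_iff: "u < off \<longleftrightarrow> u div 2 ^ k < t"
  by (simp add: off_def div_less_iff_less_mult)

lemma translate_div: "c < 2 ^ k \<Longrightarrow> translate c u div 2 ^ k = u div 2 ^ k"
  by (simp add: translate_def xor_div_pow)

lemma translate_less_off: "c < 2 ^ k \<Longrightarrow> translate c u < off \<longleftrightarrow> u < off"
  by (simp add: less_off_iff translate_div)

lemma translate_translate: "c < 2 ^ k \<Longrightarrow> translate c (translate c u) = u"
  using translate_less_off[of c u] by (auto simp: translate_def xor.assoc)

lemma sum_blk_translate:
  assumes c: "c < 2 ^ k"
  shows "(\<Sum>u\<in>blk j. g (translate c u)) = (\<Sum>u\<in>blk j. g u)"
  using c
  by (intro sum.reindex_bij_witness[of _ "translate c" "translate c"])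
     (auto simp: translate_translate mem_blk_iff translate_div)

lemma par_translate: "c < 2 ^ k \<Longrightarrow> par j (z \<circ> translate c) = par j z"
  using sum_blk_translate[of c z j] by (simp add: par_def)

lemma of_bool_bit_xor:
  "(of_bool (bit (Bit_Operations.xor u c) b) :: bit) = of_bool (bit u b) + of_bool (bit c b)" for u c :: nat
  by (simp add: bit_xor_iff)

text \<open>The position of every one in the block is shifted by \<open>c\<close>. Their number is
  odd, so the sum of the positions is shifted by \<open>c\<close> as well.\<close>

lemma sel_translate:
  assumes j: "j < t" and c: "c < 2 ^ k" and par: "par j z = 1"
  shows "sel j (z \<circ> translate c) = sel j z + cvec c"
proof
  fix v
  show "sel j (z \<circ> translate c) v = (sel j z + cvec c) v"
  proof (cases "v \<in> {off..<off + k}")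
    case True
    have "sel j (z \<circ> translate c) v
        = (\<Sum>u\<in>blk j. z (translate c u) * of_bool (bit (translate c (translate c u)) (v - off)))"
      using True c by (simp add: sel_def translate_translate)
    also have "\<dots> = (\<Sum>u\<in>blk j. z u * of_bool (bit (translate c u) (v - off)))"
      using sum_blk_translate[OF c, of "\<lambda>u. z u * of_bool (bit (translate c u) (v - off))"] by simp
    also have "\<dots> = (\<Sum>u\<in>blk j. z u * of_bool (bit u (v - off)) + z u * of_bool (bit c (v - off)))"
    proof (intro sum.cong refl)
      fix u assume "u \<in> blk j"
      then have "translate c u = Bit_Operations.xor u c"
        using blk_subset[OF j] by (auto simp: translate_def)
      then show "z u * of_bool (bit (translate c u) (v - off))
          = z u * of_bool (bit u (v - off)) + z u * of_bool (bit c (v - off))"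
        by (simp only: of_bool_bit_xor distrib_left)
    qed
    also have "\<dots> = sel j z v + par j z * of_bool (bit c (v - off))"
      using True by (simp add: sum.distrib sel_def par_def sum_distrib_right)
    finally show ?thesis
      using True par by (simp add: cvec_def)
  next
    case False
    then show ?thesis
      by (simp only: sel_def cvec_def if_False plus_fun_apply add_0_left)
  qed
qed

text \<open>The parities do not change, so the same block is selected. A flagged block must exist
  because the default vector does not move.\<close>

lemma h_translate:
  "s \<le> t \<Longrightarrow> c < 2 ^ k \<Longrightarrow> \<exists>j<s. par j z = 1 \<Longrightarrow> h s (z \<circ> translate c) = h s z + cvec c"
proof (induction s)
  case (Suc s)
  have par: "par s (z \<circ> translate c) = par s z"
    using Suc.prems by (intro par_translate)
  show ?case
  proof (cases "par s z = 1")
    case True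
    then have "sel s (z \<circ> translate c) = sel s z + cvec c"
      using Suc.prems by (intro sel_translate) auto
    then show ?thesis
      by (simp only: h.simps par True simp_thms if_True)
  next
    case False
    then have "\<exists>j<s. par j z = 1"
      using Suc.prems less_Suc_eq by auto
    then have "h s (z \<circ> translate c) = h s z + cvec c"
      using Suc.prems by (intro Suc.IH) auto
    then show ?thesis
      by (simp only: h.simps par False if_False)
  qed
qed simp

end

context block_fn_fit
begin

lemma translate_less_n: "c < 2 ^ k \<Longrightarrow> translate c u < n \<longleftrightarrow> u < n"
  using translate_less_off[of c u] fit by (auto simp: translate_def split: if_splits)

lemma translate_cube: "c < 2 ^ k \<Longrightarrow> z \<in> cube n \<Longrightarrow> z \<circ> translate c \<in> cube n"
  using translate_less_n[of c] by (auto simp: cube_def simp flip: not_less)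

lemma pmf_mu_translate:
  assumes c: "c < 2 ^ k" and z: "z \<in> cube n"
  shows "pmf (mu n) (z \<circ> translate c) = pmf (mu n) z"
proof -
  have p_translate: "p (translate c u) = p u" for u
    using translate_less_off[OF c, of u] by (auto simp: p_def translate_def)
  have "(\<Prod>u<n. if z (translate c u) = 1 then p u else 1 - p u)
      = (\<Prod>u<n. if z (translate c u) = 1 then p (translate c u) else 1 - p (translate c u))"
    by (simp only: p_translate)
  also have "\<dots> = (\<Prod>u<n. if z u = 1 then p u else 1 - p u)"
    using c by (intro prod.reindex_bij_witness[of _ "translate c" "translate c"])
      (auto simp: translate_translate translate_less_n)
  finally show ?thesis
    using c z by (simp add: pmf_mu translate_cube)
qed

text \<open>
  Permuting the coordinates of every block by \<open>u \<mapsto> u XOR c\<close> preserves \<open>mu n\<close> and all block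
  parities but shifts \<open>h\<close>, so on the flagged inputs \<open>h\<close> takes \<open>2 ^ k\<close> values with the same
  probability.
\<close>

lemma flagged_mass_le:
  "(\<Sum>z\<in>{z \<in> cube n. (\<exists>j<t. par j z = 1) \<and> h t z = w}. pmf (mu n) z) \<le> \<delta>"
proof -
  let ?A = "\<lambda>w. {z \<in> cube n. (\<exists>j<t. par j z = 1) \<and> h t z = w}"
  let ?m = "\<lambda>A. \<Sum>z\<in>A. pmf (mu n) z"
  have shift: "?m (?A (w + cvec c)) = ?m (?A w)" if c: "c < 2 ^ k" for c
  proof (rule sum.reindex_bij_witness[of _ "\<lambda>z. z \<circ> translate c" "\<lambda>z. z \<circ> translate c"])
    fix z assume "z \<in> ?A (w + cvec c)"
    then have z: "z \<in> cube n" "\<exists>j<t. par j z = 1" "h t z = w + cvec c"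
      by auto
    show "(z \<circ> translate c) \<circ> translate c = z"
      using c by (simp add: fun_eq_iff translate_translate)
    show "z \<circ> translate c \<in> ?A w"
      using z c by (simp add: translate_cube par_translate h_translate)
    show "pmf (mu n) (z \<circ> translate c) = pmf (mu n) z"
      using z c by (simp add: pmf_mu_translate)
  next
    fix z assume "z \<in> ?A w"
    then have z: "z \<in> cube n" "\<exists>j<t. par j z = 1" "h t z = w"
      by auto
    show "(z \<circ> translate c) \<circ> translate c = z"
      using c by (simp add: fun_eq_iff translate_translate)
    show "z \<circ> translate c \<in> ?A (w + cvec c)"
      using z c by (simp add: translate_cube par_translate h_translate)
  qed
  \<comment> \<open>The \<open>2 ^ k\<close> events have equal mass and are disjoint because
    \<open>cvec\<close> is injective, so together they have mass at most 1.\<close>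
  have "2 ^ k * ?m (?A w) = (\<Sum>c<2 ^ k. ?m (?A (w + cvec c)))"
    using shift by simp
  also have "\<dots> = ?m (\<Union>c<2 ^ k. ?A (w + cvec c))"
    using inj_on_cvec by (intro sum.UNION_disjoint[symmetric]) (auto simp: inj_on_def)
  also have "\<dots> \<le> ?m (cube n)"
    by (intro sum_mono2) auto
  also have "\<dots> = 1"
    using set_mu by (intro sum_pmf_eq_1) auto
  finally show ?thesis
    by (simp add: \<delta>_def field_simps)
qed

text \<open>Flagged inputs contribute at most \<open>\<delta>\<close>; the unflagged ones, all with
  the default value of \<open>h\<close>, are charged with their whole mass
  \<open>q ^ t\<close>.\<close>

lemma h_mass_le: "(\<Sum>z\<in>{z \<in> cube n. h t z = w}. pmf (mu n) z) \<le> \<delta> + q ^ t"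
proof -
  let ?F = "{z \<in> cube n. (\<exists>j<t. par j z = 1) \<and> h t z = w}"
  let ?U = "{z \<in> cube n. \<forall>l<t. par l z = 0}"
  have "(\<Sum>z\<in>{z \<in> cube n. h t z = w}. pmf (mu n) z) \<le> (\<Sum>z\<in>?F \<union> ?U. pmf (mu n) z)"
    by (rule sum_mono2) auto
  also have "\<dots> = (\<Sum>z\<in>?F. pmf (mu n) z) + (\<Sum>z\<in>?U. pmf (mu n) z)"
    by (intro sum.union_disjoint) auto
  also have "(\<Sum>z\<in>?U. pmf (mu n) z) = measure_pmf.prob (mu n) ?U"
    by (simp add: measure_measure_pmf_finite)
  also have "\<dots> \<le> measure_pmf.prob (mu n) {z. \<forall>l<t. par l z = 0}"
    by (rule measure_pmf.finite_measure_mono) auto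
  also have "\<dots> = q ^ t"
    by (rule prob_unflagged)
  finally show ?thesis
    using flagged_mass_le[of w] by linarith
qed

section \<open>Bounds on discrepancy and depth\<close>

lemma affine_correlation_mu:
  assumes "affine_subspace n S"
  shows "\<bar>\<Sum>x\<in>S. sgnb (f n x) * pmf (mu n) x\<bar> \<le> \<delta> + q ^ t"
  unfolding f_def
proof (rule affine_correlation_le[OF coord_space_fit assms])
  show "h t z \<in> coord_space {off..<off + k}" for z
    using k_pos by (rule h_coord_space)
  show "h t (z + v) = h t z" if "v \<in> coord_space {off..<off + k}" for z v
    using that by (intro h_cong) (auto simp: coord_space_def)
qed (auto simp: pmf_mu_shift h_mass_le)

definition corr :: real where
  "corr = Max ((\<lambda>S. \<bar>\<Sum>x\<in>S. sgnb (f n x) * pmf (mu n) x\<bar>) ` {S. affine_subspace n S})"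

lemma disc_eq: "disc n (f n) (mu n) = - log 2 corr"
  by (simp add: disc_def corr_def sgnb_def)

lemma finite_affine: "finite {S. affine_subspace n S}"
  by (rule finite_subset[of _ "Pow (cube n)"]) (auto simp: affine_subspace_iff)

lemma corr_ge: "affine_subspace n S \<Longrightarrow> \<bar>\<Sum>x\<in>S. sgnb (f n x) * pmf (mu n) x\<bar> \<le> corr"
  unfolding corr_def using finite_affine by (intro Max_ge) auto

lemma corr_le: "corr \<le> \<delta> + q ^ t"
  unfolding corr_def using finite_affine affine_cube affine_correlation_mu
  by (subst Max_le_iff) auto

text \<open>An exact tree has correlation 1 with \<open>f n\<close>, and by
  \<open>tree_error_ge\<close> a tree of depth \<open>d\<close> has correlation at most
  \<open>2 ^ d * corr\<close>.\<close>

lemma corr_lower: "1 \<le> 2 ^ (k + Suc t) * corr"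
proof -
  obtain T where T: "depth T \<le> k + Suc t" "\<And>x. eval_tree n T x = f n x"
    using exact_shallow_tree by blast
  have nonneg: "0 \<le> corr"
    using corr_ge[OF affine_cube] by linarith
  have "1 \<le> 2 ^ depth T * corr"
    using tree_error_ge[OF set_mu corr_ge nonneg, of T] T by simp
  also have "\<dots> \<le> 2 ^ (k + Suc t) * corr"
    using T nonneg by (intro mult_right_mono power_increasing) auto
  finally show ?thesis .
qed

lemma corr_pos: "0 < corr"
  using corr_lower by (smt (verit) mult_nonneg_nonpos zero_le_power)

lemma disc_le: "disc n (f n) (mu n) \<le> k + Suc t"
proof -
  have "0 \<le> log 2 (2 ^ (k + Suc t) * corr)"
    using corr_lower corr_pos by (subst zero_le_log_cancel_iff) auto
  also have "\<dots> = real (k + Suc t) + log 2 corr"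
    using corr_pos by (subst log_mult) (auto simp: log_nat_power simp del: power_Suc)
  finally show ?thesis
    by (simp add: disc_eq)
qed

lemma D_complexity_le: "D_complexity n (1 / 3) (f n) \<nu> \<le> k + Suc t"
proof -
  obtain T where T: "ptree_on n T" "depth T \<le> k + Suc t" "\<And>x. eval_tree n T x = f n x"
    using exact_shallow_tree by blast
  have "D_complexity n (1 / 3) (f n) \<nu> \<le> depth T"
    unfolding D_complexity_def using T by (intro Least_le exI[of _ T]) simp
  then show ?thesis
    using T by linarith
qed

text \<open>The exact tree ensures that the least depth is attained. A tree attaining it errs with
  probability at most 1/3, which leaves a correlation of at least \<open>1 - 2 / 3\<close>.\<close>

lemma D_complexity_mu_ge: "1 / 3 \<le> 2 ^ D_complexity n (1 / 3) (f n) (mu n) * corr"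
proof -
  let ?P = "\<lambda>d. \<exists>T. ptree_on n T \<and> depth T = d \<and> measure_pmf.prob (mu n) {x. eval_tree n T x \<noteq> f n x} \<le> 1 / 3"
  obtain T' where "ptree_on n T'" "\<And>x. eval_tree n T' x = f n x"
    using exact_shallow_tree by blast
  then have "\<exists>d. ?P d"
    by (intro exI[of _ "depth T'"] exI[of _ T']) simp
  then have "?P (D_complexity n (1 / 3) (f n) (mu n))"
    unfolding D_complexity_def by (rule LeastI_ex)
  then obtain T where "depth T = D_complexity n (1 / 3) (f n) (mu n)"
    "measure_pmf.prob (mu n) {x. eval_tree n T x \<noteq> f n x} \<le> 1 / 3"
    by blast
  then show ?thesis
    using tree_error_ge[OF set_mu corr_ge, of T] corr_pos by simp
qed

lemma D_product_bounds:
  "D_product n (f n) \<le> k + Suc t" "D_complexity n (1 / 3) (f n) (mu n) \<le> D_product n (f n)"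
proof -
  let ?D = "D_complexity n (1 / 3) (f n) ` {\<nu>. product_dist n \<nu>}"
  \<comment> \<open>The bound is uniform over the infinitely many product distributions, so only
    finitely many values occur and \<open>Max\<close> is the true maximum.\<close>
  have fin: "finite ?D"
    by (rule finite_subset[of _ "{..k + Suc t}"]) (use D_complexity_le in auto)
  have mem: "D_complexity n (1 / 3) (f n) (mu n) \<in> ?D"
    using product_dist_mu by auto
  show "D_product n (f n) \<le> k + Suc t"
    unfolding D_product_def using fin mem D_complexity_le by (subst Max_le_iff) auto
  show "D_complexity n (1 / 3) (f n) (mu n) \<le> D_product n (f n)"
    unfolding D_product_def using fin mem by (rule Max_ge)
qed

section \<open>Bounds on the skew cost\<close>

lemma unit_vec_off_subcube: "\<rho> off \<Longrightarrow> unit_vec off \<in> subcube n \<rho>"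
  using fit k_pos by (auto simp: subcube_def unit_vec_def cube_def)

lemma f_zero: "f n 0 = 0"
  by (simp add: f_def)

lemma f_unit_vec: "f n (unit_vec off) = 1"
proof -
  have "h t (unit_vec off) = h t 0"
    by (rule h_cong) (auto simp: unit_vec_def)
  then show ?thesis
    using fit k_pos by (simp add: f_def h_zero) (simp add: unit_vec_def)
qed

lemma pmf_mu_pos: "pmf (mu n) 0 > 0" "pmf (mu n) (unit_vec off) > 0"
proof -
  have "p u < 1" for u
    using p_bounds(2)[of u] by linarith
  moreover have "p off > 0"
    using k_pos by (simp add: p_def)
  ultimately have pos: "pmf (mu n) z > 0" if "z \<in> cube n" "\<And>u. u \<noteq> off \<Longrightarrow> z u = 0" for z
    unfolding pmf_mu[OF that(1)] using that(2) by (intro prod_pos) (smt (verit) zero_neq_one)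
  show "pmf (mu n) 0 > 0"
    by (rule pos) auto
  show "pmf (mu n) (unit_vec off) > 0"
  proof (rule pos)
    show "unit_vec off u = 0" if "u \<noteq> off" for u
      using that by (simp add: unit_vec_def)
  qed (use fit k_pos in auto)
qed

lemma random_fixing_off:
  assumes "\<rho> \<in> set_pmf (random_fixing n (mu n))"
  shows "\<rho> off"
proof -
  have "\<rho> off \<in> set_pmf (bernoulli_pmf (2 * p off))"
    using assms fit k_pos by (auto simp: random_fixing_mu set_Pi_pmf PiE_dflt_def)
  moreover have "2 * p off = 1"
    using k_pos by (simp add: p_def)
  ultimately show ?thesis
    by (cases "\<rho> off") (auto simp: set_pmf_iff)
qed

text \<open>The coordinate \<open>off\<close> has bias 1/2 and is always a star. So \<open>0\<close>
  and \<open>unit_vec off\<close> survive every fixing; they have positive mass and different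
  values, hence no tree of a zero-error distribution collapses to a leaf.\<close>

lemma skew_cost_ge:
  assumes R: "err n (f n) R (mu n) \<le> 0"
  shows "1 \<le> skew_cost n R (mu n)"
proof -
  have correct: "eval_tree n T x = f n x" if "T \<in> set_pmf R" "x \<in> set_pmf (mu n)" for T x
  proof -
    have "measure_pmf.prob (pair_pmf R (mu n)) {(T, x). eval_tree n T x \<noteq> f n x} = 0"
      using R unfolding err_def by (simp add: measure_le_0_iff)
    then have "set_pmf (pair_pmf R (mu n)) \<inter> {(T, x). eval_tree n T x \<noteq> f n x} = {}"
      by (simp add: measure_pmf_zero_iff)
    then show ?thesis
      using that by auto
  qed
  have one: "1 \<le> queries n (apply_fixing n \<rho> T) x" if "T \<in> set_pmf R" "\<rho> off" for T \<rho> x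
  proof (cases "apply_fixing n \<rho> T")
    case (Leaf b)
    have "eval_tree n T 0 = b" "eval_tree n T (unit_vec off) = b"
      using eval_apply_fixing[of 0 n \<rho> T] eval_apply_fixing[of "unit_vec off" n \<rho> T] Leaf
        unit_vec_off_subcube[of \<rho>, OF that(2)] subcube_0 by auto
    moreover have "eval_tree n T 0 = 0" "eval_tree n T (unit_vec off) = 1"
      using correct[OF that(1)] pmf_mu_pos f_zero f_unit_vec by (simp_all add: set_pmf_iff)
    ultimately show ?thesis
      by simp
  qed simp
  have avg: "1 \<le> avg_queries n (map_pmf (apply_fixing n \<rho>) R) (unif_fixing n \<rho>)" if "\<rho> off" for \<rho>
  proof -
    let ?M = "measure_pmf (pair_pmf (map_pmf (apply_fixing n \<rho>) R) (unif_fixing n \<rho>))"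
    have "1 = (\<integral>\<^sup>+ y. 1 \<partial>?M)"
      by simp
    also have "\<dots> \<le> (\<integral>\<^sup>+ (T, x). ennreal (real (queries n T x)) \<partial>?M)"
      using one that by (intro nn_integral_mono_AE) (auto simp: AE_measure_pmf_iff)
    finally show ?thesis
      by (simp add: avg_queries_def)
  qed
  have "1 = (\<integral>\<^sup>+ \<rho>. 1 \<partial>measure_pmf (random_fixing n (mu n)))"
    by simp
  also have "\<dots> \<le> skew_cost n R (mu n)"
    unfolding skew_cost_def using avg random_fixing_off
    by (intro nn_integral_mono_AE) (auto simp: AE_measure_pmf_iff)
  finally show ?thesis .
qed

lemma finite_set_random_fixing: "finite (set_pmf (random_fixing n (mu n)))"
  unfolding random_fixing_mu by (subst set_Pi_pmf) (auto intro: finite_PiE_dflt)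

text \<open>Block \<open>i\<close> is followed by \<open>t - Suc i\<close> blocks that must be
  unflagged, and its \<open>2 ^ k\<close> coordinates contribute \<open>\<delta>\<close> each, which
  adds up to 1.\<close>

lemma expected_sweep_bound:
  "measure_pmf.expectation (random_fixing n (mu n)) (\<lambda>\<rho>. measure_pmf.expectation (unif_fixing n \<rho>)
     (\<lambda>x. 1 + (\<Sum>i<t. \<Sum>u\<in>blk i. of_bool (\<rho> u) * of_bool (\<forall>l\<in>{i<..<t}. par l x = 0))))
   = 1 + (\<Sum>i<t. q ^ (t - Suc i))" (is "?lhs = _")
proof -
  let ?E = "measure_pmf.expectation (random_fixing n (mu n))"
  let ?U = "\<lambda>\<rho>. measure_pmf.expectation (unif_fixing n \<rho>)"
  have intU: "integrable (unif_fixing n \<rho>) g" for \<rho> and g :: "_ \<Rightarrow> real"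
    by (rule integrable_measure_pmf_finite) (simp add: subcube_finite)
  have intE: "integrable (random_fixing n (mu n)) g" for g :: "_ \<Rightarrow> real"
    by (rule integrable_measure_pmf_finite) (rule finite_set_random_fixing)
  have "?lhs = ?E (\<lambda>\<rho>. 1 + (\<Sum>i<t. \<Sum>u\<in>blk i. of_bool (\<rho> u) * ?U \<rho> (\<lambda>x. of_bool (\<forall>l\<in>{i<..<t}. par l x = 0))))"
    by (simp add: intU Bochner_Integration.integral_sum
        del: sum_of_bool_eq sum_mult_of_bool_eq sum_of_bool_mult_eq)
  also have "\<dots> = 1 + (\<Sum>i<t. \<Sum>u\<in>blk i. ?E (\<lambda>\<rho>. of_bool (\<rho> u) * ?U \<rho> (\<lambda>x. of_bool (\<forall>l\<in>{i<..<t}. par l x = 0))))"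
    by (simp add: intE Bochner_Integration.integral_sum
        del: sum_of_bool_eq sum_mult_of_bool_eq sum_of_bool_mult_eq)
  also have "\<dots> = 1 + (\<Sum>i<t. \<Sum>u\<in>blk i. \<delta> * q ^ (t - Suc i))"
    by (intro arg_cong2[of _ _ _ _ "(+)"] sum.cong refl, subst expected_star_unflagged) auto
  finally show ?thesis
    by (simp add: card_blk \<delta>_def)
qed

text \<open>With \<open>q \<le> 3 / 4\<close> the geometric sum is at most 4.\<close>

lemma geometric_bound: "1 + (\<Sum>i<t. q ^ (t - Suc i)) \<le> 5"
proof -
  have "(\<Sum>i<t. q ^ (t - Suc i)) = (\<Sum>i<t. q ^ i)"
    by (rule sum.nat_diff_reindex)
  also have "\<dots> = (1 - q ^ t) / (1 - q)"
    using q_bounds by (subst sum_gp_strict) auto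
  also have "\<dots> \<le> 1 / (1 / 4)"
    using q_bounds by (intro frac_le) auto
  finally show ?thesis
    by simp
qed

lemma skew_cost_sweep_le: "skew_cost n (return_pmf (sweep t)) (mu n) \<le> 5"
proof -
  let ?G = "\<lambda>\<rho> x. 1 + (\<Sum>i<t. \<Sum>u\<in>blk i. of_bool (\<rho> u) * of_bool (\<forall>l\<in>{i<..<t}. par l x = 0)) :: real"
  have G_nonneg: "0 \<le> ?G \<rho> x" for \<rho> x
    by (intro add_nonneg_nonneg sum_nonneg) auto
  have queries_le: "real (queries n (apply_fixing n \<rho> (sweep t)) x) \<le> ?G \<rho> x"
    if "x \<in> subcube n \<rho>" for \<rho> x
  proof -
    have "real (queries n (apply_fixing n \<rho> (sweep t)) x)
        \<le> real (1 + (\<Sum>i<t. of_bool (\<forall>l\<in>{i<..<t}. par l x = 0) * (\<Sum>u\<in>blk i. of_bool (\<rho> u))))"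
      using order.trans[OF queries_apply_fixing_le[OF that] live_queries_sweep[OF order_refl]]
      by (rule of_nat_mono)
    also have "\<dots> = ?G \<rho> x"
      by (simp add: sum_distrib_left sum_distrib_right mult.commute del: sum_of_bool_eq sum_mult_of_bool_eq sum_of_bool_mult_eq)
    finally show ?thesis .
  qed
  have "avg_queries n (map_pmf (apply_fixing n \<rho>) (return_pmf (sweep t))) (unif_fixing n \<rho>)
      \<le> ennreal (measure_pmf.expectation (unif_fixing n \<rho>) (?G \<rho>))" for \<rho>
  proof -
    have "avg_queries n (map_pmf (apply_fixing n \<rho>) (return_pmf (sweep t))) (unif_fixing n \<rho>)
        = (\<integral>\<^sup>+ x. ennreal (real (queries n (apply_fixing n \<rho> (sweep t)) x)) \<partial>measure_pmf (unif_fixing n \<rho>))"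
      by (simp add: avg_queries_def pair_return_pmf1)
    also have "\<dots> \<le> (\<integral>\<^sup>+ x. ennreal (?G \<rho> x) \<partial>measure_pmf (unif_fixing n \<rho>))"
      using queries_le by (intro nn_integral_mono_AE) (auto simp: AE_measure_pmf_iff intro!: ennreal_leI)
    also have "\<dots> = ennreal (measure_pmf.expectation (unif_fixing n \<rho>) (?G \<rho>))"
      using G_nonneg
      by (intro nn_integral_eq_integral integrable_measure_pmf_finite) (auto simp: subcube_finite)
    finally show ?thesis .
  qed
  then have "skew_cost n (return_pmf (sweep t)) (mu n)
      \<le> (\<integral>\<^sup>+ \<rho>. ennreal (measure_pmf.expectation (unif_fixing n \<rho>) (?G \<rho>)) \<partial>measure_pmf (random_fixing n (mu n)))"
    unfolding skew_cost_def by (intro nn_integral_mono) auto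
  also have "\<dots> = ennreal (measure_pmf.expectation (random_fixing n (mu n))
      (\<lambda>\<rho>. measure_pmf.expectation (unif_fixing n \<rho>) (?G \<rho>)))"
    using G_nonneg finite_set_random_fixing
    by (intro nn_integral_eq_integral integrable_measure_pmf_finite) (auto intro!: Bochner_Integration.integral_nonneg)
  also have "\<dots> \<le> ennreal 5"
    unfolding expected_sweep_bound by (intro ennreal_leI geometric_bound)
  finally show ?thesis
    by simp
qed

lemma skew_measure_bounds:
  "1 \<le> skew_measure n 0 (f n) (mu n)" "skew_measure n 0 (f n) (mu n) \<le> 5"
proof -
  let ?Rs = "{R. rand_ptree_on n R \<and> err n (f n) R (mu n) \<le> 0}"
  let ?I = "INF R\<in>?Rs. skew_cost n R (mu n)"
  have "eval_tree n (sweep t) x = f n x" for x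
    by (simp add: f_def eval_sweep)
  then have "err n (f n) (return_pmf (sweep t)) (mu n) = 0"
    by (simp add: err_def pair_return_pmf1)
  then have "return_pmf (sweep t) \<in> ?Rs"
    by (simp add: rand_ptree_on_def ptree_on_sweep)
  then have upper: "?I \<le> 5"
    by (rule INF_lower2) (rule skew_cost_sweep_le)
  have lower: "1 \<le> ?I"
    using skew_cost_ge by (intro INF_greatest) auto
  have "enn2real ?I \<le> enn2real 5"
    using upper by (intro enn2real_mono) auto
  then show "skew_measure n 0 (f n) (mu n) \<le> 5"
    by (simp add: skew_measure_def)
  \<comment> \<open>Finiteness of \<open>?I\<close> matters here, since \<open>enn2real\<close>
    sends infinity to 0.\<close>
  have "enn2real 1 \<le> enn2real ?I"
    using upper lower by (intro enn2real_mono) (auto intro: le_less_trans[OF upper])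
  then show "1 \<le> skew_measure n 0 (f n) (mu n)"
    by (simp add: skew_measure_def)
qed

end

section \<open>Choice of the number of blocks\<close>

locale block_fn_log = block_fn_fit +
  assumes t_eq: "t = 3 * k"
begin

text \<open>Since \<open>(3 / 4) ^ 3 = 27 / 64 \<le> 1 / 2\<close>, three blocks for each bit of
  \<open>y\<close> make the unflagged mass no larger than \<open>\<delta>\<close>.\<close>

lemma corr_le_pow: "corr \<le> 2 * (1 / 2) ^ k"
proof -
  have "q ^ t \<le> (3 / 4) ^ t"
    using q_bounds by (intro power_mono) auto
  also have "\<dots> = (27 / 64 :: real) ^ k"
    by (simp add: t_eq power_mult power3_eq_cube)
  also have "\<dots> \<le> (1 / 2) ^ k"
    by (intro power_mono) auto
  finally show ?thesis
    using corr_le by (simp add: \<delta>_def power_divide)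
qed

lemma disc_ge: "real k - 1 \<le> disc n (f n) (mu n)"
proof -
  have "log 2 corr \<le> log 2 (2 * (1 / 2) ^ k)"
    using corr_le_pow corr_pos by simp
  also have "\<dots> = 1 - real k"
    by (subst log_mult) (auto simp: log_nat_power log_divide power_divide)
  finally show ?thesis
    by (simp add: disc_eq)
qed

lemma D_product_ge: "real k - 3 \<le> real (D_product n (f n))"
proof -
  let ?d = "D_complexity n (1 / 3) (f n) (mu n)"
  have "(1 / 3 :: real) \<le> 2 ^ ?d * (2 * (1 / 2) ^ k)"
    by (rule order.trans[OF D_complexity_mu_ge]) (intro mult_left_mono corr_le_pow, simp)
  then have "2 ^ k \<le> (6 * 2 ^ ?d :: real)"
    by (simp add: power_divide field_simps)
  \<comment> \<open>The factor \<open>6 = 3 * 2\<close> is rounded up to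
    \<open>2 ^ 3\<close>.\<close>
  also have "\<dots> \<le> 2 ^ (?d + 3)"
    by (simp add: power_add)
  finally have "k \<le> ?d + 3"
    by simp
  then show ?thesis
    using D_product_bounds(2) by linarith
qed

end

section \<open>Asymptotics\<close>

text \<open>For positive \<open>n\<close> this keeps \<open>2 ^ k\<close> at most the square root of
  \<open>n\<close>, which leaves room for \<open>3 * k\<close> blocks when \<open>n\<close> is
  large.\<close>

definition block_size_log :: "nat \<Rightarrow> nat" where
  "block_size_log n = nat \<lfloor>log 2 (real n) / 2\<rfloor>"

lemma block_size_log_bounds:
  assumes "2 ^ 16 \<le> n"
  defines "L \<equiv> log 2 (real n)" and "k \<equiv> block_size_log n"
  shows "16 \<le> L" "real k \<le> L / 2" "L / 2 - 1 < real k"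
proof -
  have "log 2 (2 ^ 16) \<le> L"
    unfolding L_def using assms(1) by (subst log_le_cancel_iff) (auto simp flip: of_nat_power_le_of_nat_cancel_iff)
  then show L: "16 \<le> L"
    using log_pow_cancel[of "2 :: real" 16] by simp
  then show "real k \<le> L / 2" "L / 2 - 1 < real k"
    unfolding k_def block_size_log_def L_def by linarith+
qed

text \<open>Blocks and \<open>y\<close> together occupy \<open>3 * k * 2 ^ k + k\<close>
  coordinates, which is at most \<open>4 * k * 2 ^ k \<le> 2 ^ k * 2 ^ k \<le> n\<close>.\<close>

lemma block_fn_log_block_size_log:
  assumes n: "2 ^ 16 \<le> n"
  defines "k \<equiv> block_size_log n"
  shows "block_fn_log k (3 * k) n"
proof
  note bounds = block_size_log_bounds[OF n, folded k_def]
  have "7 < real k"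
    using bounds by linarith
  then have k: "8 \<le> k"
    by linarith
  then show "k > 0"
    by simp
  have "real (2 ^ k * 2 ^ k) = 2 ^ (2 * k)"
    by (simp add: mult_2 power_add)
  also have "\<dots> = 2 powr real (2 * k)"
    by (simp only: powr_realpow zero_less_numeral)
  also have "\<dots> \<le> 2 powr log 2 (real n)"
    using bounds by (intro powr_mono) auto
  also have "\<dots> = real n"
    using n by (subst powr_log_cancel) auto
  finally have "2 ^ k * 2 ^ k \<le> n"
    by (simp only: of_nat_le_iff)
  moreover have "4 * k \<le> 2 ^ k"
    using k by (induction k rule: dec_induct) auto
  then have "4 * k * 2 ^ k \<le> 2 ^ k * 2 ^ k"
    by (rule mult_right_mono) auto
  moreover have "k * 1 \<le> k * 2 ^ k"
    by (intro mult_left_mono) auto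
  ultimately show "block_fn.off k (3 * k) + k \<le> n"
    unfolding block_fn.off_def by linarith
qed simp

lemma bigtheta_sandwich:
  fixes u v :: "nat \<Rightarrow> real"
  assumes "0 < c" "0 < d" "\<And>n. N \<le> n \<Longrightarrow> 0 \<le> v n \<and> c * v n \<le> u n \<and> u n \<le> d * v n"
  shows "u \<in> \<Theta>(v)"
proof (rule bigthetaI')
  show "eventually (\<lambda>n. c * norm (v n) \<le> norm (u n) \<and> norm (u n) \<le> d * norm (v n)) sequentially"
    using eventually_ge_at_top[of N]
  proof eventually_elim
    case (elim n)
    moreover from this have "0 \<le> u n"
      using assms by (smt (verit) mult_nonneg_nonneg)
    ultimately show ?case
      using assms(3)[of n] by simp
  qed
qed (use assms in auto)

theorem theorem34:
  shows "\<exists>(f :: nat \<Rightarrow> (nat \<Rightarrow> bit) \<Rightarrow> bit) (\<mu> :: nat \<Rightarrow> (nat \<Rightarrow> bit) pmf).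
           (\<forall>n. zero_biased n (\<mu> n)) \<and>
           (\<lambda>n. real (D_product n (f n))) \<in> \<Theta>(\<lambda>n. disc n (f n) (\<mu> n)) \<and>
           (\<lambda>n. disc n (f n) (\<mu> n)) \<in> \<Theta>(\<lambda>n. log 2 (real n)) \<and>
           (\<lambda>n. skew_measure n 0 (f n) (\<mu> n)) \<in> \<Theta>(\<lambda>n. 1)"
proof -
  let ?k = block_size_log
  define F where "F n = block_fn.f (?k n) (3 * ?k n) n" for n
  define M where "M n = block_fn.mu (?k n) (3 * ?k n) n" for n
  have "zero_biased n (M n)" for n
    unfolding M_def by (rule block_fn.zero_biased_mu)
  moreover have disc: "(\<lambda>n. disc n (F n) (M n)) \<in> \<Theta>(\<lambda>n. log 2 (real n))"
  proof (rule bigtheta_sandwich[of "1 / 4" 3 "2 ^ 16"])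
    fix n :: nat assume n: "2 ^ 16 \<le> n"
    interpret block_fn_log "?k n" "3 * ?k n" n
      by (rule block_fn_log_block_size_log[OF n])
    show "0 \<le> log 2 (real n) \<and> 1 / 4 * log 2 (real n) \<le> disc n (F n) (M n)
        \<and> disc n (F n) (M n) \<le> 3 * log 2 (real n)"
      using disc_ge disc_le block_size_log_bounds[OF n] by (simp add: F_def M_def)
  qed auto
  moreover have "(\<lambda>n. real (D_product n (F n))) \<in> \<Theta>(\<lambda>n. log 2 (real n))"
  \<comment> \<open>With \<open>L = log 2 (real n)\<close>, the lower bound
    \<open>k - 3 > L / 2 - 4\<close> reaches \<open>L / 4\<close> once \<open>L \<ge> 16\<close>,
    whence the threshold. The upper bound is
    \<open>4 * k + 1 \<le> 2 * L + 1 \<le> 3 * L\<close>.\<close>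
  proof (rule bigtheta_sandwich[of "1 / 4" 3 "2 ^ 16"])
    fix n :: nat assume n: "2 ^ 16 \<le> n"
    interpret block_fn_log "?k n" "3 * ?k n" n
      by (rule block_fn_log_block_size_log[OF n])
    have "real (D_product n (F n)) \<le> real (?k n + Suc (3 * ?k n))"
      using D_product_bounds(1) unfolding F_def by (rule of_nat_mono)
    then show "0 \<le> log 2 (real n) \<and> 1 / 4 * log 2 (real n) \<le> real (D_product n (F n))
        \<and> real (D_product n (F n)) \<le> 3 * log 2 (real n)"
      using D_product_ge block_size_log_bounds[OF n] by (simp add: F_def)
  qed auto
  then have "(\<lambda>n. real (D_product n (F n))) \<in> \<Theta>(\<lambda>n. disc n (F n) (M n))"
    using disc landau_theta.trans bigtheta_sym by metis
  moreover have "(\<lambda>n. skew_measure n 0 (F n) (M n)) \<in> \<Theta>(\<lambda>n. 1)"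
  proof (rule bigtheta_sandwich[of 1 5 "2 ^ 16"])
    fix n :: nat assume n: "2 ^ 16 \<le> n"
    interpret block_fn_log "?k n" "3 * ?k n" n
      by (rule block_fn_log_block_size_log[OF n])
    show "0 \<le> (1 :: real) \<and> 1 * 1 \<le> skew_measure n 0 (F n) (M n)
        \<and> skew_measure n 0 (F n) (M n) \<le> 5 * 1"
      using skew_measure_bounds by (simp add: F_def M_def)
  qed auto
  ultimately show ?thesis
    by blast
qed

end
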